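(* Let $\lambda,\mu$ be partitions with $\widetilde\lambda_1\le n$ and $\widetilde\mu_1\le n$, and let $v_\mu$ be the canonical highest weight vector of the irreducible $gl(n)$-module $Schur_{\widetilde\mu}(n)$ with highest weight $\mu$. If $\lambda\nsubseteq\mu$ (containment of Ferrers diagrams), then $\mathbf S_\lambda(n)\cdot v_\mu=0$.
   Context: Virtual symbols. Let $\mathcal L=\{1,\dots,n\}$, and let $\mathcal A_0=\{\alpha_1,\dots,\alpha_{m_0}\}$, $\mathcal A_1=\{\beta_1,\dots,\beta_{m_1}\}$ be finite sets of auxiliary (virtual) symbols, with $m_0,m_1$ sufficiently large. Put $|a|=0\in\mathbb Z_2$ for $a\in\mathcal A_0$ and $|a|=1\in\mathbb Z_2$ for $a\in\mathcal A_1\cup\mathcal L$. Let $gl(m_0|m_1+n)$ be the complex Lie superalgebra with basis $e_{a,b}$, $a,b\in\mathcal A_0\cup\mathcal A_1\cup\mathcal L$, $|e_{a,b}|=|a|+|b|$, and superbracket $[e_{a,b},e_{c,d}]=\delta_{bc}e_{a,d}-(-1)^{(|a|+|b|)(|c|+|d|)}\delta_{ad}e_{c,b}$. Its enveloping superalgebra $\mathbf U(gl(m_0|m_1+n))$ contains $\mathbf U(gl(n))$ as the subalgebra generated by $e_{i,j}$, $i,j\in\mathcal L$. Devirtualization. A product $e_{a_m,b_m}\cdots e_{a_1,b_1}$ is irregular if there are $i\le m$ and a virtual symbol $\gamma\in\mathcal A_0\cup\mathcal A_1$ with $\#\{j\le i: b_j=\gamma\}>\#\{j<i: a_j=\gamma\}$.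 Let $\mathbf{Irr}$ be the left ideal of $\mathbf U(gl(m_0|m_1+n))$ generated by the irregular products. The sum $Virt=\mathbf U(gl(n))+\mathbf{Irr}$ is direct and is a subalgebra, in which $\mathbf{Irr}$ is a two-sided ideal; $\mathfrak p:Virt\to\mathbf U(gl(n))$ denotes the projection with kernel $\mathbf{Irr}$ (an algebra epimorphism). Tableaux. A Young tableau of shape $\lambda$ over an alphabet is any filling of the cells of the Ferrers diagram of $\lambda$ (rows of lengths $\lambda_1\ge\lambda_2\ge\cdots$). For tableaux $S,T$ of the same shape, $e_{S,T}$ is the product of the $e_{S(c),T(c)}$ over the cells $c$, read row by row from top to bottom, left to right in each row. $D^*_\lambda$ is the tableau of shape $\lambda$ whose $r$-th row is $\beta_1\beta_2\cdots\beta_{\lambda_r}$, and $C^*_\lambda$ the tableau of shape $\lambda$ whose $r$-th row is $\alpha_r\alpha_r\cdots\alpha_r$ (the $\alpha$'s and $\beta$'s being arbitrary distinct positive, resp. negative, virtual symbols). For tableaux $S,T$ of shape $\lambda$ over $\mathcal L$, the double Young-Capelli bitableau is $[\,\boxed{S\,|\,T}\,]=\mathfrak p\big(e_{S,C^*_\lambda}e_{C^*_\lambda,D^*_\lambda}e_{D^*_\lambda,C^*_\lambda}e_{C^*_\lambda,T}\big)\in\mathbf U(gl(n))$; the argument of $\mathfrak p$ lies in $Virt$ and the result does not depend on the choice of virtual symbols. Schur elements. $\widetilde\lambda$ is the conjugate partition and $H(\lambda)=H(\widetilde\lambda)$ the product of the hook lengths of all boxes of the Ferrers diagram. For $\widetilde\lambda_1\le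 n$, $\mathbf S_\lambda(n)=\frac1{H(\widetilde\lambda)}\sum_S[\,\boxed{S\,|\,S}\,]\in\mathbf U(gl(n))$, the sum over all tableaux $S$ of shape $\widetilde\lambda$ on $\mathcal L$ with strictly increasing rows (no condition on columns); $\mathbf S_\emptyset(n)=\mathbf 1$. Schur modules. Let $\mathbb C[M_{n,d}]$ be the polynomial algebra in commuting variables $(i|j)$, $1\le i\le n$, $1\le j\le d$, with $gl(n)$ acting by derivations, $e_{i,j}\cdot(k|t)=\delta_{jk}(i|t)$, and $d$ sufficiently large. For a partition $\nu$ with $\nu_1\le n$, $Schur_\nu(n)\subset\mathbb C[M_{n,d}]$ is the span of all products $\prod_r\det[(X_{r,s}|t)]_{s,t=1,\dots,\nu_r}$, $X=(X_{r,s})$ any tableau of shape $\nu$ over $\mathcal L$; it is an irreducible $gl(n)$-module with highest weight $\widetilde\nu$. Its canonical highest weight vector $v_{\widetilde\nu}$ is, up to a fixed sign, $\prod_r\det[(s|t)]_{s,t=1,\dots,\nu_r}$. *)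

theory Defs
  imports "HOL-Library.Poly_Mapping" "HOL-Library.Cardinality" "Jordan_Normal_Form.Determinant"
begin

section \<open>Enveloping superalgebras of general linear Lie superalgebras\<close>

text \<open>Only the residue of \<open>parity a\<close> modulo 2 is relevant: parities occur only as exponents of \<open>-1\<close>.\<close>

class graded =
  fixes parity :: "'a \<Rightarrow> nat"

text \<open>The proper symbols alone, all of parity 1; with this alphabet the enveloping superalgebra
  below is the enveloping algebra of \<open>gl(n)\<close>, where \<open>n\<close> is the cardinality of \<open>'l\<close>.\<close>

datatype 'l letter = Letter (unletter: 'l)

instantiation letter :: (type) graded
begin
definition parity_letter :: "'a letter \<Rightarrow> nat" where
  "parity_letter a = 1"
instance ..
end

text \<open>The alphabet of \<open>gl(m\<^sub>0|m\<^sub>1+n)\<close>: positive virtual symbols \<open>'p\<close>, negative virtual symbols \<open>'q\<close>,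
  proper symbols \<open>'l\<close>, with \<open>m\<^sub>0\<close>, \<open>m\<^sub>1\<close>, \<open>n\<close> the cardinalities of these types.\<close>

datatype ('p, 'q, 'l) symbol = Pos 'p | Neg 'q | Proper 'l

instantiation symbol :: (type, type, type) graded
begin
primrec parity_symbol :: "('a, 'b, 'c) symbol \<Rightarrow> nat" where
  "parity_symbol (Pos _) = 0"
| "parity_symbol (Neg _) = 1"
| "parity_symbol (Proper _) = 1"
instance ..
end

primrec virtual :: "('p, 'q, 'l) symbol \<Rightarrow> bool" where
  "virtual (Pos _) = True"
| "virtual (Neg _) = True"
| "virtual (Proper _) = False"

text \<open>Words in the generators \<open>e\<^bsub>a,b\<^esub>\<close>, written additively so that polynomial mappings
  on words form the monoid algebra, i.e. the tensor algebra of the Lie superalgebra.\<close>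

datatype 's word = Word (letters: "('s \<times> 's) list")

instantiation word :: (type) monoid_add
begin
definition zero_word :: "'a word" where
  "zero_word = Word []"
definition plus_word :: "'a word \<Rightarrow> 'a word \<Rightarrow> 'a word" where
  "plus_word u v = Word (letters u @ letters v)"
instance by standard (simp_all add: zero_word_def plus_word_def)
end

type_synonym 's tensor = "'s word \<Rightarrow>\<^sub>0 complex"

definition gen :: "'s \<Rightarrow> 's \<Rightarrow> 's tensor" where
  "gen a b = Poly_Mapping.single (Word [(a, b)]) 1"

definition superbracket :: "'s::graded \<Rightarrow> 's \<Rightarrow> 's \<Rightarrow> 's \<Rightarrow> 's tensor" where
  "superbracket a b c d =
     (if b = c then gen a d else 0)
     - (-1) ^ ((parity a + parity b) * (parity c + parity d)) * (if a = d then gen c b else 0)"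

definition relator :: "'s::graded \<Rightarrow> 's \<Rightarrow> 's \<Rightarrow> 's \<Rightarrow> 's tensor" where
  "relator a b c d =
     gen a b * gen c d
     - (-1) ^ ((parity a + parity b) * (parity c + parity d)) * (gen c d * gen a b)
     - superbracket a b c d"

lemma sum_keys_add:
  fixes x y :: "'k \<Rightarrow>\<^sub>0 'a::comm_monoid_add" and h :: "'k \<Rightarrow> 'a \<Rightarrow> 'b::comm_monoid_add"
  assumes "\<And>k. h k 0 = 0" and "\<And>k c d. h k (c + d) = h k c + h k d"
  shows "(\<Sum>k\<in>Poly_Mapping.keys (x + y). h k (Poly_Mapping.lookup (x + y) k))
    = (\<Sum>k\<in>Poly_Mapping.keys x. h k (Poly_Mapping.lookup x k))
      + (\<Sum>k\<in>Poly_Mapping.keys y. h k (Poly_Mapping.lookup y k))"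
  using assms by (intro setsum_keys_plus_distrib) auto

lemma sum_keys_single:
  assumes "\<And>k. h k 0 = 0"
  shows "(\<Sum>k\<in>Poly_Mapping.keys (Poly_Mapping.single w c).
      h k (Poly_Mapping.lookup (Poly_Mapping.single w c) k)) = h w c"
  using assms by simp

lemma poly_mapping_add_induct [case_names zero single add]:
  fixes x :: "'k \<Rightarrow>\<^sub>0 'a::comm_monoid_add"
  assumes "P 0" and "\<And>k c. P (Poly_Mapping.single k c)"
    and "\<And>x y. P x \<Longrightarrow> P y \<Longrightarrow> P (x + y)"
  shows "P x"
proof (induction x rule: update_induct)
  case const
  show ?case by fact
next
  case (update f a b)
  have "Poly_Mapping.update a b f = Poly_Mapping.single a b + f"
    using update(1) by (intro poly_mapping_eqI)
      (auto simp: lookup_update lookup_add lookup_single when_def in_keys_iff)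
  with update assms show ?case by simp
qed

inductive_set relator_ideal :: "'s::graded tensor set" where
  zero: "0 \<in> relator_ideal"
| add: "x \<in> relator_ideal \<Longrightarrow> y \<in> relator_ideal \<Longrightarrow> x + y \<in> relator_ideal"
| base: "u * relator a b c d * v \<in> relator_ideal"

lemma relator_ideal_mult_left: "x \<in> relator_ideal \<Longrightarrow> u * x \<in> relator_ideal"
proof (induction rule: relator_ideal.induct)
  case (base w a b c d v)
  have "(u * w) * relator a b c d * v \<in> relator_ideal" by (rule relator_ideal.base)
  then show ?case by (simp add: mult.assoc)
qed (auto simp: distrib_left intro: relator_ideal.intros)

lemma relator_ideal_mult_right: "x \<in> relator_ideal \<Longrightarrow> x * u \<in> relator_ideal"
proof (induction rule: relator_ideal.induct)
  case (base w a b c d v)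
  have "w * relator a b c d * (v * u) \<in> relator_ideal" by (rule relator_ideal.base)
  then show ?case by (simp add: mult.assoc)
qed (auto simp: distrib_right intro: relator_ideal.intros)

lemma relator_ideal_uminus: "x \<in> relator_ideal \<Longrightarrow> - x \<in> relator_ideal"
  using relator_ideal_mult_left[of x "-1"] by simp

lemma relator_ideal_diff:
  "x \<in> relator_ideal \<Longrightarrow> y \<in> relator_ideal \<Longrightarrow> x - y \<in> relator_ideal"
  using relator_ideal.add[OF _ relator_ideal_uminus] by fastforce

lemma lookup_mult_zero_word:
  fixes x y :: "'s tensor"
  shows "Poly_Mapping.lookup (x * y) 0 = Poly_Mapping.lookup x 0 * Poly_Mapping.lookup y 0"
proof (induction x rule: poly_mapping_add_induct)
  case (single u c)
  show ?case
  proof (induction y rule: poly_mapping_add_induct)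
    case (single v d)
    have "u + v = 0 \<longleftrightarrow> u = 0 \<and> v = 0"
      by (cases u; cases v) (simp add: plus_word_def zero_word_def)
    then show ?case by (auto simp: mult_single lookup_single when_def)
  qed (simp_all add: lookup_add distrib_left)
qed (simp_all add: lookup_add distrib_right)

lemma lookup_relator_ideal_zero:
  assumes "x \<in> relator_ideal"
  shows "Poly_Mapping.lookup x 0 = 0"
  using assms
proof (induction rule: relator_ideal.induct)
  case (base u a b c d v)
  have [simp]: "Poly_Mapping.lookup (gen a b) 0 = 0" for a b :: 'a
    by (simp add: gen_def lookup_single zero_word_def)
  have "Poly_Mapping.lookup (relator a b c d) 0 = 0"
    by (simp add: relator_def superbracket_def lookup_minus lookup_mult_zero_word)
  then show ?case by (simp add: lookup_mult_zero_word)
qed (simp_all add: lookup_add)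

quotient_type (overloaded) 's uea = "'s::graded tensor" / "\<lambda>x y. x - y \<in> relator_ideal"
proof (rule equivpI)
  show "reflp (\<lambda>x y::'s tensor. x - y \<in> relator_ideal)"
    by (simp add: reflp_def relator_ideal.zero)
  show "symp (\<lambda>x y::'s tensor. x - y \<in> relator_ideal)"
    using relator_ideal_uminus by (fastforce simp: symp_def)
  show "transp (\<lambda>x y::'s tensor. x - y \<in> relator_ideal)"
    using relator_ideal.add by (fastforce simp: transp_def)
qed

instantiation uea :: (graded) ring_1
begin

lift_definition zero_uea :: "'a uea" is 0 .

lift_definition one_uea :: "'a uea" is 1 .

lift_definition plus_uea :: "'a uea \<Rightarrow> 'a uea \<Rightarrow> 'a uea" is "(+)"
  using relator_ideal.add by (fastforce simp: add_diff_add)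

lift_definition uminus_uea :: "'a uea \<Rightarrow> 'a uea" is uminus
  using relator_ideal_uminus by fastforce

lift_definition minus_uea :: "'a uea \<Rightarrow> 'a uea \<Rightarrow> 'a uea" is "(-)"
proof -
  fix x x' y y' :: "'a tensor"
  assume "x - x' \<in> relator_ideal" "y - y' \<in> relator_ideal"
  then have "(x - x') - (y - y') \<in> relator_ideal" by (rule relator_ideal_diff)
  then show "(x - y) - (x' - y') \<in> relator_ideal" by (simp add: algebra_simps)
qed

lift_definition times_uea :: "'a uea \<Rightarrow> 'a uea \<Rightarrow> 'a uea" is "(*)"
proof -
  fix x x' y y' :: "'a tensor"
  assume "x - x' \<in> relator_ideal" "y - y' \<in> relator_ideal"
  then have "(x - x') * y + x' * (y - y') \<in> relator_ideal"
    by (intro relator_ideal.add relator_ideal_mult_left relator_ideal_mult_right)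
  then show "x * y - x' * y' \<in> relator_ideal" by (simp add: algebra_simps)
qed

instance
proof
  fix a b c :: "'a uea"
  show "a + b + c = a + (b + c)"
    by transfer (simp add: relator_ideal.zero add.assoc)
  show "a + b = b + a"
    by transfer (simp add: relator_ideal.zero add.commute)
  show "0 + a = a"
    by transfer (simp add: relator_ideal.zero)
  show "- a + a = 0"
    by transfer (simp add: relator_ideal.zero)
  show "a - b = a + - b"
    by transfer (simp add: relator_ideal.zero)
  show "a * b * c = a * (b * c)"
    by transfer (simp add: relator_ideal.zero mult.assoc)
  show "1 * a = a"
    by transfer (simp add: relator_ideal.zero)
  show "a * 1 = a"
    by transfer (simp add: relator_ideal.zero)
  show "(a + b) * c = a * c + b * c"
    by transfer (simp add: relator_ideal.zero distrib_right)
  show "a * (b + c) = a * b + a * c"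
    by transfer (simp add: relator_ideal.zero distrib_left)
  show "(0::'a uea) \<noteq> 1"
    by transfer (use lookup_relator_ideal_zero[of "0 - 1 :: 'a tensor"] in \<open>auto simp: lookup_minus\<close>)
qed

end

lift_definition scale_uea :: "complex \<Rightarrow> 's::graded uea \<Rightarrow> 's uea" (infixr "*\<^sub>U" 75)
  is "\<lambda>c x. Poly_Mapping.single 0 c * x"
  using relator_ideal_mult_left by (fastforce simp flip: right_diff_distrib)

lift_definition E :: "'s::graded \<Rightarrow> 's \<Rightarrow> 's uea" is gen .


section \<open>Polynomials in the variables \<open>(i|t)\<close> and the action of \<open>gl(n)\<close>\<close>

text \<open>\<open>'l\<close> indexes the rows and \<open>'d\<close> the columns of the generic matrix: this is \<open>\<complex>[M\<^bsub>n,d\<^esub>]\<close>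
  with \<open>d\<close> the cardinality of \<open>'d\<close>. Exponent vectors are finitely supported functions.\<close>

type_synonym ('l, 'd) mpoly = "(('l \<times> 'd) \<Rightarrow>\<^sub>0 nat) \<Rightarrow>\<^sub>0 complex"

definition var :: "'l \<Rightarrow> 'd \<Rightarrow> ('l, 'd) mpoly" where
  "var i t = Poly_Mapping.single (Poly_Mapping.single (i, t) 1) 1"

definition const :: "complex \<Rightarrow> ('l, 'd) mpoly" where
  "const c = Poly_Mapping.single 0 c"

definition partial_deriv :: "'l \<Rightarrow> 'd \<Rightarrow> ('l, 'd) mpoly \<Rightarrow> ('l, 'd) mpoly" where
  "partial_deriv i t f =
     (\<Sum>m\<in>Poly_Mapping.keys f. Poly_Mapping.single (m - Poly_Mapping.single (i, t) 1)
        (of_nat (Poly_Mapping.lookup m (i, t)) * Poly_Mapping.lookup f m))"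

text \<open>The derivation mapping \<open>(k|t)\<close> to \<open>\<delta>\<^bsub>jk\<^esub> (i|t)\<close>.\<close>

definition polarization :: "'l \<Rightarrow> 'l \<Rightarrow> ('l, 'd::finite) mpoly \<Rightarrow> ('l, 'd) mpoly" where
  "polarization i j f = (\<Sum>t\<in>UNIV. var i t * partial_deriv j t f)"

definition word_action :: "'l letter word \<Rightarrow> ('l, 'd::finite) mpoly \<Rightarrow> ('l, 'd) mpoly" where
  "word_action w = foldr (\<lambda>(a, b). polarization (unletter a) (unletter b)) (letters w)"

definition tensor_action :: "'l letter tensor \<Rightarrow> ('l, 'd::finite) mpoly \<Rightarrow> ('l, 'd) mpoly" where
  "tensor_action x f =
     (\<Sum>w\<in>Poly_Mapping.keys x. const (Poly_Mapping.lookup x w) * word_action w f)"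

lemma partial_deriv_add: "partial_deriv i t (f + g) = partial_deriv i t f + partial_deriv i t g"
  unfolding partial_deriv_def by (rule sum_keys_add) (simp_all add: distrib_left single_add)

lemma partial_deriv_single:
  "partial_deriv i t (Poly_Mapping.single m c) =
     Poly_Mapping.single (m - Poly_Mapping.single (i, t) 1) (of_nat (Poly_Mapping.lookup m (i, t)) * c)"
  unfolding partial_deriv_def by (rule sum_keys_single) simp

lemma partial_deriv_zero [simp]: "partial_deriv i t 0 = 0"
  by (simp add: partial_deriv_def)

lemma partial_deriv_sum: "partial_deriv i t (\<Sum>a\<in>A. f a) = (\<Sum>a\<in>A. partial_deriv i t (f a))"
  by (induction A rule: infinite_finite_induct) (simp_all add: partial_deriv_add)

lemma partial_deriv_const_mult: "partial_deriv i t (const c * f) = const c * partial_deriv i t f"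
proof (induction f rule: poly_mapping_add_induct)
  case (single m d)
  then show ?case by (simp add: const_def mult_single partial_deriv_single mult.left_commute)
qed (simp_all add: partial_deriv_add distrib_left)

lemma partial_deriv_var_mult:
  "partial_deriv i t (var k u * f) = (if (i, t) = (k, u) then f else 0) + var k u * partial_deriv i t f"
proof (induction f rule: poly_mapping_add_induct)
  case (single m c)
  let ?s = "\<lambda>x. Poly_Mapping.single x (1::nat)"
  show ?case
  proof (cases "(i, t) = (k, u)")
    case True
    show ?thesis
    proof (cases "Poly_Mapping.lookup m (i, t) = 0")
      case True
      with \<open>(i, t) = (k, u)\<close> show ?thesis
        by (simp add: var_def mult_single partial_deriv_single lookup_add)
    next
      case False
      then have "?s (i, t) + (m - ?s (i, t)) = m"
        by (intro poly_mapping_eqI) (auto simp: lookup_add lookup_minus lookup_single when_def)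
      with \<open>(i, t) = (k, u)\<close> show ?thesis
        by (simp add: var_def mult_single partial_deriv_single lookup_add distrib_right single_add)
    qed
  next
    case False
    show ?thesis
    proof (cases "Poly_Mapping.lookup m (i, t) = 0")
      case True
      with \<open>(i, t) \<noteq> (k, u)\<close> show ?thesis
        by (auto simp: var_def mult_single partial_deriv_single lookup_add lookup_single)
    next
      case nz: False
      from False nz have "?s (k, u) + m - ?s (i, t) = ?s (k, u) + (m - ?s (i, t))"
        by (intro poly_mapping_eqI) (auto simp: lookup_add lookup_minus lookup_single when_def)
      with False show ?thesis
        by (auto simp: var_def mult_single partial_deriv_single lookup_add lookup_single)
    qed
  qed
qed (simp_all add: partial_deriv_add distrib_left)

lemma partial_deriv_commute:
  "partial_deriv i t (partial_deriv j u f) = partial_deriv j u (partial_deriv i t f)"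
proof (induction f rule: poly_mapping_add_induct)
  case (single m c)
  show ?case
    by (cases "(i, t) = (j, u)")
      (auto simp: partial_deriv_single lookup_minus lookup_single diff_diff_eq add.commute mult.left_commute)
qed (simp_all add: partial_deriv_add)

lemma polarization_add: "polarization i j (f + g) = polarization i j f + polarization i j g"
  by (simp add: polarization_def partial_deriv_add distrib_left sum.distrib)

lemma polarization_const_mult: "polarization i j (const c * f) = const c * polarization i j f"
  by (simp add: polarization_def partial_deriv_const_mult sum_distrib_left mult.left_commute)

lemma polarization_var_mult:
  "polarization i j (var k u * f) = (if j = k then var i u * f else 0) + var k u * polarization i j f"
  by (simp add: polarization_def partial_deriv_var_mult distrib_left sum.distrib sum_distrib_left
      mult.left_commute if_distrib[of "\<lambda>x. _ * x"] sum.delta cong: if_cong)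

lemma polarization_commutator:
  fixes f :: "('l, 'd::finite) mpoly"
  shows "polarization i j (polarization k l f) - polarization k l (polarization i j f) =
     (if j = k then polarization i l f else 0) - (if i = l then polarization k j f else 0)"
proof -
  have *: "polarization i j (polarization k l f) = (if j = k then polarization i l f else 0)
      + (\<Sum>t\<in>UNIV. \<Sum>u\<in>UNIV. var i t * (var k u * partial_deriv j t (partial_deriv l u f)))"
    for i j k l and f :: "('l, 'd) mpoly"
    by (simp add: polarization_def partial_deriv_sum partial_deriv_var_mult distrib_left sum.distrib
        sum_distrib_left if_distrib[of "\<lambda>x. _ * x"] sum.delta cong: if_cong)
  have "(\<Sum>t\<in>UNIV. \<Sum>u\<in>UNIV. var i t * (var k u * partial_deriv j t (partial_deriv l u f)))
      = (\<Sum>u\<in>UNIV. \<Sum>t\<in>UNIV. var k u * (var i t * partial_deriv l u (partial_deriv j t f)))"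
    by (subst sum.swap) (simp add: partial_deriv_commute mult.left_commute)
  then show ?thesis by (auto simp: *)
qed

lemma word_action_add: "word_action w (f + g) = word_action w f + word_action w g"
proof -
  have "foldr h ws (f + g) = foldr h ws f + foldr h ws g"
    if "\<And>a f g. h a (f + g) = h a f + h a g" for ws :: "('a letter \<times> 'a letter) list"
      and h :: "_ \<Rightarrow> ('a, 'b) mpoly \<Rightarrow> ('a, 'b) mpoly"
    using that by (induction ws) simp_all
  then show ?thesis by (simp add: word_action_def polarization_add split: prod.split)
qed

lemma word_action_const_mult: "word_action w (const c * f) = const c * word_action w f"
proof -
  have "foldr h ws (const c * f) = const c * foldr h ws f"
    if "\<And>a f. h a (const c * f) = const c * h a f" for ws :: "('a letter \<times> 'a letter) list"
      and h :: "_ \<Rightarrow> ('a, 'b) mpoly \<Rightarrow> ('a, 'b) mpoly"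
    using that by (induction ws) simp_all
  then show ?thesis by (simp add: word_action_def polarization_const_mult split: prod.split)
qed

lemma word_action_zero [simp]: "word_action w 0 = 0"
  using word_action_add[of w 0 0] by simp

lemma word_action_plus: "word_action (v + w) f = word_action v (word_action w f)"
  by (simp add: word_action_def plus_word_def)

lemma const_zero [simp]: "const 0 = 0"
  by (simp add: const_def)

lemma const_add: "const (c + d) = const c + const d"
  by (simp add: const_def single_add)

lemma const_mult: "const (c * d) = const c * const d"
  by (simp add: const_def mult_single)

lemma tensor_action_add_left: "tensor_action (x + y) f = tensor_action x f + tensor_action y f"
  unfolding tensor_action_def by (rule sum_keys_add) (simp_all add: const_add distrib_right)

lemma tensor_action_single: "tensor_action (Poly_Mapping.single w c) f = const c * word_action w f"
  unfolding tensor_action_def by (rule sum_keys_single) simp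

lemma tensor_action_zero_left [simp]: "tensor_action 0 f = 0"
  by (simp add: tensor_action_def)

lemma tensor_action_add_right: "tensor_action x (f + g) = tensor_action x f + tensor_action x g"
  by (simp add: tensor_action_def word_action_add distrib_left sum.distrib)

lemma tensor_action_zero_right [simp]: "tensor_action x 0 = 0"
  by (simp add: tensor_action_def)

lemma tensor_action_uminus_left: "tensor_action (- x) f = - tensor_action x f"
  using tensor_action_add_left[of x "- x" f] by (simp add: eq_neg_iff_add_eq_0 add.commute)

lemma tensor_action_diff_left: "tensor_action (x - y) f = tensor_action x f - tensor_action y f"
  using tensor_action_add_left[of x "- y" f] by (simp add: tensor_action_uminus_left)

lemma tensor_action_mult: "tensor_action (x * y) f = tensor_action x (tensor_action y f)"
proof (induction x rule: poly_mapping_add_induct)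
  case (single u c)
  show ?case
  proof (induction y rule: poly_mapping_add_induct)
    case (single v d)
    show ?case
      by (simp add: mult_single tensor_action_single word_action_plus word_action_const_mult
          const_mult mult.assoc)
  qed (simp_all add: distrib_left tensor_action_add_left tensor_action_add_right)
qed (simp_all add: distrib_right tensor_action_add_left)

lemma tensor_action_gen:
  "tensor_action (gen a b) f = polarization (unletter a) (unletter b) f"
  by (simp add: gen_def tensor_action_single word_action_def const_def)

lemma tensor_action_relator: "tensor_action (relator a b c d) f = 0"
  using polarization_commutator[of "unletter a" "unletter b" "unletter c" "unletter d" f]
  by (auto simp: relator_def superbracket_def parity_letter_def tensor_action_diff_left
      tensor_action_mult tensor_action_gen letter.expand)

lemma tensor_action_relator_ideal: "x \<in> relator_ideal \<Longrightarrow> tensor_action x f = 0"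
  by (induction rule: relator_ideal.induct)
    (simp_all add: tensor_action_add_left tensor_action_mult tensor_action_relator)

lift_definition action :: "'l letter uea \<Rightarrow> ('l, 'd::finite) mpoly \<Rightarrow> ('l, 'd) mpoly"
  is tensor_action
  using tensor_action_relator_ideal by (fastforce simp: tensor_action_diff_left fun_eq_iff)


section \<open>The embedding of \<open>U(gl(n))\<close> into \<open>U(gl(m\<^sub>0|m\<^sub>1+n))\<close> and devirtualization\<close>

definition proper :: "'l letter \<Rightarrow> ('p, 'q, 'l) symbol" where
  "proper a = Proper (unletter a)"

definition embed_word :: "'l letter word \<Rightarrow> ('p, 'q, 'l) symbol word" where
  "embed_word w = Word (map (map_prod proper proper) (letters w))"

definition embed_tensor :: "'l letter tensor \<Rightarrow> ('p, 'q, 'l) symbol tensor" where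
  "embed_tensor x =
     (\<Sum>w\<in>Poly_Mapping.keys x. Poly_Mapping.single (embed_word w) (Poly_Mapping.lookup x w))"

lemma embed_tensor_add: "embed_tensor (x + y) = embed_tensor x + embed_tensor y"
  unfolding embed_tensor_def by (rule sum_keys_add) (simp_all add: single_add)

lemma embed_tensor_single:
  "embed_tensor (Poly_Mapping.single w c) = Poly_Mapping.single (embed_word w) c"
  unfolding embed_tensor_def by (rule sum_keys_single) simp

lemma embed_tensor_zero [simp]: "embed_tensor 0 = 0"
  by (simp add: embed_tensor_def)

lemma embed_tensor_uminus: "embed_tensor (- x) = - embed_tensor x"
  using embed_tensor_add[of x "- x"] by (simp add: eq_neg_iff_add_eq_0 add.commute)

lemma embed_tensor_diff: "embed_tensor (x - y) = embed_tensor x - embed_tensor y"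
  using embed_tensor_add[of x "- y"] by (simp add: embed_tensor_uminus)

lemma embed_tensor_mult: "embed_tensor (x * y) = embed_tensor x * embed_tensor y"
proof (induction x rule: poly_mapping_add_induct)
  case (single u c)
  show ?case
  proof (induction y rule: poly_mapping_add_induct)
    case (single v d)
    show ?case
      by (simp add: mult_single embed_tensor_single embed_word_def plus_word_def)
  qed (simp_all add: distrib_left embed_tensor_add)
qed (simp_all add: distrib_right embed_tensor_add)

lemma embed_tensor_gen: "embed_tensor (gen a b) = gen (proper a) (proper b)"
  by (simp add: gen_def embed_tensor_single embed_word_def)

lemma embed_tensor_relator:
  "embed_tensor (relator a b c d) = relator (proper a) (proper b) (proper c) (proper d)"
  by (auto simp: relator_def superbracket_def embed_tensor_diff embed_tensor_mult embed_tensor_gen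
      parity_letter_def proper_def letter.expand)

lemma embed_tensor_relator_ideal: "x \<in> relator_ideal \<Longrightarrow> embed_tensor x \<in> relator_ideal"
  by (induction rule: relator_ideal.induct)
    (simp_all add: embed_tensor_add embed_tensor_mult embed_tensor_relator relator_ideal.intros)

lift_definition embed :: "'l letter uea \<Rightarrow> ('p, 'q, 'l) symbol uea" is embed_tensor
  using embed_tensor_relator_ideal by (fastforce simp flip: embed_tensor_diff)

definition e_word :: "('s::graded \<times> 's) list \<Rightarrow> 's uea" where
  "e_word ps = prod_list (map (\<lambda>(a, b). E a b) ps)"

text \<open>The list \<open>[(a\<^sub>m, b\<^sub>m), \<dots>, (a\<^sub>1, b\<^sub>1)]\<close> stands for the product
  \<open>e\<^bsub>a\<^sub>m,b\<^sub>m\<^esub> \<cdots> e\<^bsub>a\<^sub>1,b\<^sub>1\<^esub>\<close>, so the index \<open>i\<close> counts from the right.\<close>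

definition irregular :: "(('p, 'q, 'l) symbol \<times> ('p, 'q, 'l) symbol) list \<Rightarrow> bool" where
  "irregular ps \<longleftrightarrow>
     (\<exists>i\<in>{1..length ps}. \<exists>\<gamma>. virtual \<gamma> \<and>
        count_list (map snd (take i (rev ps))) \<gamma> > count_list (map fst (take (i - 1) (rev ps))) \<gamma>)"

inductive_set Irr :: "('p, 'q, 'l) symbol uea set" where
  zero: "0 \<in> Irr"
| add: "x \<in> Irr \<Longrightarrow> y \<in> Irr \<Longrightarrow> x + y \<in> Irr"
| base: "irregular ps \<Longrightarrow> u * e_word ps \<in> Irr"

definition Virt :: "('p, 'q, 'l) symbol uea set" where
  "Virt = {embed u + y | u y. y \<in> Irr}"

text \<open>The projection onto the first summand of \<open>Virt = embed ` UNIV \<oplus> Irr\<close>, the target being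
  identified with \<open>U(gl(n))\<close> along the injection \<open>embed\<close>. For arguments in \<open>Virt\<close> the choice
  operator has exactly one candidate, by directness of the sum.\<close>

definition devirt :: "('p, 'q, 'l) symbol uea \<Rightarrow> 'l letter uea" where
  "devirt x = (SOME u. x - embed u \<in> Irr)"


section \<open>Partitions and tableaux\<close>

text \<open>Rows and columns are indexed from 0.\<close>

definition is_partition :: "nat list \<Rightarrow> bool" where
  "is_partition p \<longleftrightarrow> sorted_wrt (\<ge>) p \<and> 0 \<notin> set p"

definition part :: "nat list \<Rightarrow> nat \<Rightarrow> nat" where
  "part p i = (if i < length p then p ! i else 0)"

definition ferrers :: "nat list \<Rightarrow> (nat \<times> nat) set" where
  "ferrers p = {(i, j). j < part p i}"

definition conj_partition :: "nat list \<Rightarrow> nat list" where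
  "conj_partition p = map (\<lambda>j. card {i. (i, j) \<in> ferrers p}) [0..<part p 0]"

definition hook_length :: "nat list \<Rightarrow> nat \<times> nat \<Rightarrow> nat" where
  "hook_length p = (\<lambda>(i, j).
     card {(i', j') \<in> ferrers p. (i' = i \<and> j \<le> j') \<or> (j' = j \<and> i \<le> i')})"

definition hook_product :: "nat list \<Rightarrow> nat" where
  "hook_product p = (\<Prod>c\<in>ferrers p. hook_length p c)"

text \<open>A tableau is the list of its rows.\<close>

definition tableaux :: "nat list \<Rightarrow> 'a list list set" where
  "tableaux p = {S. map length S = p}"

definition e_tableaux :: "'s::graded list list \<Rightarrow> 's list list \<Rightarrow> 's uea" where
  "e_tableaux S T = e_word (zip (concat S) (concat T))"

definition D_star :: "(nat \<Rightarrow> 'q) \<Rightarrow> nat list \<Rightarrow> ('p, 'q, 'l) symbol list list" where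
  "D_star \<beta> p = map (\<lambda>k. map (\<lambda>s. Neg (\<beta> s)) [0..<k]) p"

definition C_star :: "(nat \<Rightarrow> 'p) \<Rightarrow> nat list \<Rightarrow> ('p, 'q, 'l) symbol list list" where
  "C_star \<alpha> p = map (\<lambda>r. replicate (p ! r) (Pos (\<alpha> r))) [0..<length p]"

definition double_Young_Capelli ::
  "(nat \<Rightarrow> 'p) \<Rightarrow> (nat \<Rightarrow> 'q) \<Rightarrow> nat list \<Rightarrow> 'l list list \<Rightarrow> 'l list list \<Rightarrow> 'l letter uea" where
  "double_Young_Capelli \<alpha> \<beta> p S T = devirt (
     e_tableaux (map (map Proper) S) (C_star \<alpha> p) *
     e_tableaux (C_star \<alpha> p) (D_star \<beta> p) *
     e_tableaux (D_star \<beta> p) (C_star \<alpha> p) *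
     e_tableaux (C_star \<alpha> p) (map (map Proper) T))"

definition schur_element ::
  "(nat \<Rightarrow> 'p) \<Rightarrow> (nat \<Rightarrow> 'q) \<Rightarrow> nat list \<Rightarrow> 'l::{finite, linorder} letter uea" where
  "schur_element \<alpha> \<beta> p = (if p = [] then 1 else
     (1 / of_nat (hook_product (conj_partition p))) *\<^sub>U
       (\<Sum>S | S \<in> tableaux (conj_partition p) \<and> (\<forall>row\<in>set S. sorted_wrt (<) row).
          double_Young_Capelli \<alpha> \<beta> (conj_partition p) S S))"


section \<open>Schur modules\<close>

text \<open>\<open>nth_element s\<close> is the element number \<open>s + 1\<close> of a finite linear order, so that the
  alphabet \<open>{1, \<dots>, n}\<close> is \<open>nth_element 0 < \<cdots> < nth_element (n - 1)\<close>.\<close>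

definition nth_element :: "nat \<Rightarrow> 'a::{finite, linorder}" where
  "nth_element s = sorted_list_of_set UNIV ! s"

definition row_minor :: "'l list \<Rightarrow> ('l, 'd::{finite, linorder}) mpoly" where
  "row_minor xs = det (mat (length xs) (length xs) (\<lambda>(s, t). var (xs ! s) (nth_element t)))"

definition bideterminant :: "'l list list \<Rightarrow> ('l, 'd::{finite, linorder}) mpoly" where
  "bideterminant X = (\<Prod>row\<leftarrow>X. row_minor row)"

inductive_set schur_module :: "nat list \<Rightarrow> ('l, 'd::{finite, linorder}) mpoly set"
  for p :: "nat list" where
  zero: "0 \<in> schur_module p"
| add: "f \<in> schur_module p \<Longrightarrow> g \<in> schur_module p \<Longrightarrow> f + g \<in> schur_module p"
| base: "X \<in> tableaux p \<Longrightarrow> const c * bideterminant X \<in> schur_module p"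

text \<open>The canonical highest weight vector of \<open>schur_module p\<close>, up to sign; its weight is the
  conjugate of \<open>p\<close>.\<close>

definition highest_weight_vector ::
  "nat list \<Rightarrow> ('l::{finite, linorder}, 'd::{finite, linorder}) mpoly" where
  "highest_weight_vector p = bideterminant (map (\<lambda>k. map nth_element [0..<k]) p)"

lemma highest_weight_vector_in_schur_module: "highest_weight_vector p \<in> schur_module p"
proof -
  have "map (\<lambda>k. map nth_element [0..<k]) p \<in> (tableaux p :: 'a list list set)"
    by (simp add: tableaux_def comp_def)
  from schur_module.base[OF this, of 1] show ?thesis
    by (simp add: highest_weight_vector_def const_def)
qed

end

theory Submission
  imports "HOL-Analysis.Complex_Transcendental" "HOL-Library.Function_Algebras" Defs
begin

text \<open>The algebra \<open>U(gl(m\<^sub>0|m\<^sub>1+n))\<close> acts by superpolarizations on the supersymmetric algebra in the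
  variables \<open>(a|t)\<close>, which contains \<open>\<complex>[M\<^bsub>n,d\<^esub>]\<close>; irregular products kill the latter, so that
  \<open>devirt x\<close> acts on it as \<open>x\<close> does. It suffices to see that \<open>u = e\<^bsub>D,C\<^esub> e\<^bsub>C,T\<^esub> v\<close> vanishes. This is a
  polynomial in the even variables \<open>(\<beta>\<^sub>s|t)\<close>, \<open>(i|t)\<close> alone. Since the \<open>e\<^bsub>\<beta>,\<alpha>\<^esub>\<close> of one row of the tableaux
  anticommute, \<open>u\<close> is a highest weight vector of weight \<open>\<lambda>\<close> for the row operations among the rows
  \<open>\<beta>\<^sub>s\<close>; since the column operations commute with all superpolarizations, \<open>u\<close> inherits from \<open>v\<close> that it
  is a highest weight vector of weight \<open>\<mu>\<close> for them. By Gaussian elimination \<open>u\<close> is determined by its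
  values at matrices whose \<open>\<beta>\<close>-part is diagonal, and there its degree \<open>\<lambda>\<^sub>t\<close> in the \<open>t\<close>-th diagonal entry is at
  most its total degree \<open>\<mu>\<^sub>t\<close> in the \<open>t\<close>-th column, unless \<open>u = 0\<close>.\<close>

section \<open>Polynomials as functions\<close>

text \<open>For the action to say anything about \<open>devirt\<close>, the products must lie in
  \<open>Virt\<close>; they do because each virtual symbol occurs in them equally often as first and
  as second index. Row and column operations appear in two forms. As differential operators they
  have commutation relations with superpolarizations, which carry the highest weight conditions
  through the tableau words. As substitutions of points, namely shears and scalings, they drive the
  elimination. Differentiating and integrating along one-parameter families translates between the
  two, and this is why polynomials are treated as functions of complex points; continuity then also
  settles the points with vanishing pivots. The weights come from counting: the shape is conjugate
  to \<lambda>, so \<open>\<beta> s\<close> stands in as many rows of \<open>D_star\<close> as part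
  s of \<lambda> says, and column t enters as many of the minors in v as part t of \<mu> says. Since
  \<lambda> is not contained in \<mu>, some index violates the degree bound, and the right half of
  every summand then kills v.\<close>

lemma mpoly_induct [case_names const add var]:
  fixes f :: "('l, 'd) mpoly"
  assumes const: "\<And>c. P (const c)" and add: "\<And>f g. P f \<Longrightarrow> P g \<Longrightarrow> P (f + g)"
    and var: "\<And>i t f. P f \<Longrightarrow> P (var i t * f)"
  shows "P f"
proof (induction f rule: poly_mapping_add_induct)
  case zero
  show ?case using const[of 0] by simp
next
  case (single m c)
  \<comment> \<open>Phrased as closure under the shift by m, so that a sum of exponent vectors is
    treated by composing two shifts.\<close>
  have "\<forall>m'. P (Poly_Mapping.single m' c) \<longrightarrow> P (Poly_Mapping.single (m + m') c)"
  proof (induction m rule: poly_mapping_add_induct)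
    case (single x n)
    have "P (Poly_Mapping.single (Poly_Mapping.single x n + m) c)"
      if "P (Poly_Mapping.single m c)" for m
    proof (induction n)
      case (Suc n)
      have "Poly_Mapping.single (Poly_Mapping.single x (Suc n) + m) c
        = var (fst x) (snd x) * Poly_Mapping.single (Poly_Mapping.single x n + m) c"
        by (simp add: var_def mult_single flip: single_add add.assoc)
      then show ?case using var[OF Suc] by simp
    qed (use that in simp)
    then show ?case by blast
  qed (simp_all add: add.assoc)
  from this[rule_format, of 0] show ?case using const[of c] by (simp add: const_def)
qed (rule add)

text \<open>The coefficient map is a parameter because two instances occur: the identity for
  evaluation at complex points, and \<open>const\<close> for renaming variables.\<close>

definition subst_mpoly ::
  "(complex \<Rightarrow> 'r) \<Rightarrow> ('l \<times> 'd \<Rightarrow> 'r) \<Rightarrow> ('l::finite, 'd::finite) mpoly \<Rightarrow> 'r::comm_ring_1" where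
  "subst_mpoly h g f = (\<Sum>m\<in>Poly_Mapping.keys f.
     h (Poly_Mapping.lookup f m) * (\<Prod>x\<in>UNIV. g x ^ Poly_Mapping.lookup m x))"

locale coeff_hom = comm_ring_hom hom for hom :: "complex \<Rightarrow> 'r::comm_ring_1"
begin

lemma subst_mpoly_add: "subst_mpoly hom g (f + f') = subst_mpoly hom g f + subst_mpoly hom g f'"
  unfolding subst_mpoly_def by (rule sum_keys_add) (simp_all add: hom_distribs distrib_right)

lemma subst_mpoly_single:
  "subst_mpoly hom g (Poly_Mapping.single m c) = hom c * (\<Prod>x\<in>UNIV. g x ^ Poly_Mapping.lookup m x)"
  unfolding subst_mpoly_def by (rule sum_keys_single) simp

lemma subst_mpoly_const: "subst_mpoly hom g (const c) = hom c"
  by (simp add: const_def subst_mpoly_single)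

lemma subst_mpoly_mult: "subst_mpoly hom g (f * f') = subst_mpoly hom g f * subst_mpoly hom g f'"
proof (induction f rule: poly_mapping_add_induct)
  case (single m c)
  show ?case
  proof (induction f' rule: poly_mapping_add_induct)
    case (single m' c')
    show ?case
      by (simp add: mult_single subst_mpoly_single hom_distribs lookup_add power_add prod.distrib)
  qed (simp_all add: distrib_left subst_mpoly_add, simp add: subst_mpoly_def)
qed (simp_all add: distrib_right subst_mpoly_add, simp add: subst_mpoly_def)

lemma subst_mpoly_var: "subst_mpoly hom g (var i t) = g (i, t)"
proof -
  have "(\<Prod>x\<in>UNIV. g x ^ Poly_Mapping.lookup (Poly_Mapping.single (i, t) 1) x)
      = (\<Prod>x\<in>UNIV. if x = (i, t) then g x else 1)"
    by (intro prod.cong) (auto simp: lookup_single when_def)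
  then show ?thesis by (simp add: var_def subst_mpoly_single prod.delta)
qed

lemma comm_ring_hom_subst_mpoly: "comm_ring_hom (subst_mpoly hom g)"
  by unfold_locales
    (simp_all add: subst_mpoly_add subst_mpoly_mult subst_mpoly_const[of g 0, simplified]
      subst_mpoly_const[of g 1, unfolded const_def, simplified])

end

lemma coeff_hom_const: "coeff_hom const"
  by unfold_locales (simp_all add: const_add const_mult, simp add: const_def)

lemma coeff_hom_id: "coeff_hom (\<lambda>c. c)"
  by unfold_locales simp_all

abbreviation eval_mpoly :: "('l \<times> 'd \<Rightarrow> complex) \<Rightarrow> ('l::finite, 'd::finite) mpoly \<Rightarrow> complex" where
  "eval_mpoly \<equiv> subst_mpoly (\<lambda>c. c)"

lemmas eval_mpoly_simps [simp] =
  coeff_hom.subst_mpoly_add[OF coeff_hom_id]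
  coeff_hom.subst_mpoly_mult[OF coeff_hom_id]
  coeff_hom.subst_mpoly_const[OF coeff_hom_id]
  coeff_hom.subst_mpoly_var[OF coeff_hom_id]

interpretation eval_mpoly: comm_ring_hom "eval_mpoly y" for y :: "'l::finite \<times> 'd::finite \<Rightarrow> complex"
  by (rule coeff_hom.comm_ring_hom_subst_mpoly[OF coeff_hom_id])

section \<open>Derivatives along curves of points\<close>

lemma partial_deriv_const [simp]: "partial_deriv i t (const c) = 0"
  by (simp add: const_def partial_deriv_single)

lemma lookup_partial_deriv:
  "Poly_Mapping.lookup (partial_deriv i t f) m
    = of_nat (Suc (Poly_Mapping.lookup m (i, t))) * Poly_Mapping.lookup f (m + Poly_Mapping.single (i, t) 1)"
proof (induction f rule: poly_mapping_add_induct)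
  case (single k c)
  let ?e = "Poly_Mapping.single (i, t) (1::nat)"
  show ?case
  proof (cases "Poly_Mapping.lookup k (i, t) = 0")
    case True
    then have "k \<noteq> m + ?e"
      by (auto simp: lookup_add)
    with True show ?thesis by (simp add: partial_deriv_single lookup_single when_def)
  next
    case False
    then have *: "k - ?e + ?e = k"
      by (intro poly_mapping_eqI) (auto simp: lookup_add lookup_minus lookup_single when_def)
    have "k - ?e = m \<longleftrightarrow> k = m + ?e"
      using * by auto
    then show ?thesis
      by (auto simp: partial_deriv_single lookup_single when_def lookup_add)
  qed
qed (simp_all add: partial_deriv_add lookup_add distrib_left)

lemma has_field_derivative_eval_mpoly:
  fixes f :: "('l::finite, 'd::finite) mpoly"
  assumes "\<And>x. ((\<lambda>s. y s x) has_field_derivative y' x) (at s)"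
  shows "((\<lambda>s. eval_mpoly (y s) f) has_field_derivative
    (\<Sum>x\<in>UNIV. y' x * eval_mpoly (y s) (partial_deriv (fst x) (snd x) f))) (at s)"
proof (induction f rule: mpoly_induct)
  case (const c)
  show ?case by simp
next
  case (add f g)
  show ?case
    using DERIV_add[OF add.IH] by (simp add: partial_deriv_add distrib_left sum.distrib)
next
  case (var i t f)
  have *: "(\<Sum>x\<in>UNIV. y' x * eval_mpoly (y s) (partial_deriv (fst x) (snd x) (var i t * f)))
      = (\<Sum>x\<in>UNIV. (if x = (i, t) then y' x * eval_mpoly (y s) f else 0)
          + y s (i, t) * (y' x * eval_mpoly (y s) (partial_deriv (fst x) (snd x) f)))"
    by (intro sum.cong refl) (auto simp: partial_deriv_var_mult distrib_left mult.left_commute)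
  show ?case
    unfolding *
    using DERIV_mult[OF assms[of "(i, t)"] var.IH]
    by (simp add: sum.distrib sum.delta mult.commute flip: sum_distrib_left)
qed

text \<open>If f vanishes everywhere, so do its partial derivatives, and the coefficient at m is up
  to a positive integer a coefficient of one of them in lower degree. The induction on the degree of
  m ends with the value at the origin.\<close>

lemma eval_mpoly_eq_zero_imp_zero:
  fixes f :: "('l::finite, 'd::finite) mpoly"
  assumes "\<And>y. eval_mpoly y f = 0"
  shows "f = 0"
proof (rule poly_mapping_eqI)
  fix m :: "'l \<times> 'd \<Rightarrow>\<^sub>0 nat"
  have "\<forall>f::('l, 'd) mpoly. (\<forall>y. eval_mpoly y f = 0) \<longrightarrow> Poly_Mapping.lookup f m = 0"
  proof (induction "\<Sum>x\<in>UNIV. Poly_Mapping.lookup m x" arbitrary: m)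
    case 0
    then have "m = 0" by (auto intro: poly_mapping_eqI)
    have "eval_mpoly (\<lambda>_. 0) f = Poly_Mapping.lookup f 0" for f :: "('l, 'd) mpoly"
    proof (induction f rule: mpoly_induct)
      case (var i t f)
      have "u + Poly_Mapping.single (i, t) 1 \<noteq> 0" for u :: "'l \<times> 'd \<Rightarrow>\<^sub>0 nat"
      proof
        assume "u + Poly_Mapping.single (i, t) 1 = 0"
        then have "Poly_Mapping.lookup (u + Poly_Mapping.single (i, t) 1) (i, t) = 0" by simp
        then show False by (simp add: lookup_add)
      qed
      then have "Poly_Mapping.lookup (var i t * f) 0 = 0"
        by (induction f rule: poly_mapping_add_induct)
          (simp_all add: var_def mult_single lookup_single when_def distrib_left lookup_add add.commute)
      then show ?case by simp
    qed (simp_all add: lookup_add, simp add: const_def)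
    then show ?case using \<open>m = 0\<close> by metis
  next
    case (Suc n)
    then have "\<exists>x. Poly_Mapping.lookup m x \<noteq> 0"
      by (metis Zero_not_Suc sum.not_neutral_contains_not_neutral)
    then obtain i t where it: "Poly_Mapping.lookup m (i, t) \<noteq> 0" by auto
    let ?e = "Poly_Mapping.single (i, t) (1::nat)"
    have m: "m = (m - ?e) + ?e"
      using it by (intro poly_mapping_eqI) (auto simp: lookup_add lookup_minus lookup_single when_def)
    have "(\<Sum>x\<in>UNIV. Poly_Mapping.lookup m x)
        = (\<Sum>x\<in>UNIV. Poly_Mapping.lookup (m - ?e) x) + (\<Sum>x\<in>UNIV. Poly_Mapping.lookup ?e x)"
      by (subst m) (simp add: lookup_add sum.distrib)
    moreover have "(\<Sum>x\<in>UNIV. Poly_Mapping.lookup ?e x) = 1"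
      by (simp add: lookup_single when_def sum.delta')
    ultimately have n: "n = (\<Sum>x\<in>UNIV. Poly_Mapping.lookup (m - ?e) x)"
      using Suc.hyps(2) by simp
    show ?case
    proof (intro allI impI)
      fix f :: "('l, 'd) mpoly"
      assume f: "\<forall>y. eval_mpoly y f = 0"
      have "eval_mpoly y (partial_deriv i t f) = 0" for y
      proof -
        let ?y = "\<lambda>s x. y x + (if x = (i, t) then s else 0)"
        have "((\<lambda>s. eval_mpoly (?y s) f) has_field_derivative
            (\<Sum>x\<in>UNIV. (if x = (i, t) then 1 else 0)
              * eval_mpoly (?y 0) (partial_deriv (fst x) (snd x) f))) (at 0)"
          by (rule has_field_derivative_eval_mpoly) (auto intro!: derivative_eq_intros)
        moreover have "((\<lambda>s. eval_mpoly (?y s) f) has_field_derivative 0) (at 0)"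
          using f by simp
        ultimately have "(\<Sum>x\<in>UNIV. (if x = (i, t) then 1 else 0)
            * eval_mpoly (?y 0) (partial_deriv (fst x) (snd x) f)) = 0"
          by (rule DERIV_unique)
        then show ?thesis by (simp add: if_distrib[of "\<lambda>x. x * _"] sum.delta cong: if_cong)
      qed
      then have "Poly_Mapping.lookup (partial_deriv i t f) (m - ?e) = 0"
        using Suc.hyps(1)[OF n] by blast
      then show "Poly_Mapping.lookup f m = 0"
        by (simp only: lookup_partial_deriv flip: m) (simp flip: of_nat_Suc)
    qed
  qed
  with assms show "Poly_Mapping.lookup f m = Poly_Mapping.lookup 0 m" by simp
qed

text \<open>The product with \<open>exp (- k * s)\<close> has derivative zero. This integrates
  infinitesimal conditions, with k = 0 for shears and k the weight for scalings.\<close>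

lemma eval_mpoly_flow:
  fixes f :: "('l::finite, 'd::finite) mpoly"
  assumes "\<And>s x. ((\<lambda>s. y s x) has_field_derivative y' s x) (at s)"
    and "\<And>s. (\<Sum>x\<in>UNIV. y' s x * eval_mpoly (y s) (partial_deriv (fst x) (snd x) f))
      = k * eval_mpoly (y s) f"
  shows "eval_mpoly (y s) f = exp (k * s) * eval_mpoly (y 0) f"
proof -
  let ?g = "\<lambda>s. exp (- k * s) * eval_mpoly (y s) f"
  have "((\<lambda>s. eval_mpoly (y s) f) has_field_derivative k * eval_mpoly (y s) f) (at s)" for s
    using has_field_derivative_eval_mpoly[where y = y and y' = "y' s" and f = f, OF assms(1)] assms(2) by simp
  then have "(?g has_field_derivative 0) (at s within UNIV)" for s
    by (auto intro!: derivative_eq_intros)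
  then have "\<exists>c. \<forall>s\<in>UNIV. ?g s = c"
    by (intro has_field_derivative_zero_constant) auto
  then have "?g s = ?g 0" by (metis UNIV_I)
  then show ?thesis by (simp add: exp_minus field_simps)
qed

section \<open>Highest weight vectors for row and column operations\<close>

text \<open>Extends an identity from nonzero parameters to 0; the parameter will be a scaling factor
  or a pivot.\<close>

lemma isCont_eq_at_zero:
  fixes g :: "complex \<Rightarrow> complex"
  assumes "isCont g 0" and "\<And>c. c \<noteq> 0 \<Longrightarrow> g c = a"
  shows "g 0 = a"
proof -
  have "g \<midarrow>0\<rightarrow> g 0" using assms(1) by (simp add: isCont_def)
  moreover have "g \<midarrow>0\<rightarrow> a"
    using assms(2) by (intro tendsto_eventually eventually_at_filter[THEN iffD2] always_eventually) blast
  ultimately show ?thesis using LIM_unique by blast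
qed

text \<open>\<open>Rw\<close> is the set of all rows of the matrix of variables, and \<open>f\<close> is a highest weight vector
  for the column operations and for the row operations among the rows \<open>b 0, \<dots>, b (k - 1)\<close>.
  Gaussian elimination reduces a point with nonzero pivots to one whose \<open>j\<^sub>0\<close>-th row and column
  (within the rows \<open>b\<close>) are diagonal; there, scaling the column and scaling the row differ only by
  scaling the remaining variables of the column, in which \<open>f\<close> is a polynomial.\<close>

lemma biweight_vector_eq_zero:
  fixes f :: "('s::finite, 'd::finite) mpoly" and b :: "nat \<Rightarrow> 's" and e :: "nat \<Rightarrow> 'd"
  assumes inj: "inj_on b {..<k}" and Rw: "b ` {..<k} \<subseteq> Rw" and e: "bij_betw e {..<d} UNIV"
    and row: "\<And>i j c y. i < j \<Longrightarrow> j < k \<Longrightarrow>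
      eval_mpoly (\<lambda>x. if fst x = b j then y x + c * y (b i, snd x) else y x) f = eval_mpoly y f"
    and row_scale: "\<And>i c y. i < k \<Longrightarrow> c \<noteq> 0 \<Longrightarrow>
      eval_mpoly (\<lambda>x. if fst x = b i then c * y x else y x) f = c ^ lam i * eval_mpoly y f"
    and col: "\<And>i j c y. i < j \<Longrightarrow> j < d \<Longrightarrow>
      eval_mpoly (\<lambda>x. if fst x \<in> Rw \<and> snd x = e j then y x + c * y (fst x, e i) else y x) f
        = eval_mpoly y f"
    and col_scale: "\<And>i c y. i < d \<Longrightarrow> c \<noteq> 0 \<Longrightarrow>
      eval_mpoly (\<lambda>x. if fst x \<in> Rw \<and> snd x = e i then c * y x else y x) f = c ^ mu i * eval_mpoly y f"
    and j0: "j0 < k" "j0 < d \<Longrightarrow> mu j0 < lam j0" "d \<le> j0 \<Longrightarrow> 0 < lam j0"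
  shows "f = 0"
proof -
  have b_eq: "b i = b j \<longleftrightarrow> i = j" if "i < k" "j < k" for i j
    using inj that by (auto simp: inj_on_def)
  have e_eq: "e i = e j \<longleftrightarrow> i = j" if "i < d" "j < d" for i j
    using e that by (auto simp: bij_betw_def inj_on_def)
  have b_Rw: "b i \<in> Rw" if "i < k" for i
    using Rw that by auto
  have e_ex: "\<exists>i<d. e i = t" for t
    using e by (metis UNIV_I bij_betw_def imageE lessThan_iff)
  have cont: "isCont (\<lambda>s. eval_mpoly (y s) f) s"
    if "\<And>s x. ((\<lambda>s. y s x) has_field_derivative y' x) (at s)" for y :: "complex \<Rightarrow> 's \<times> 'd \<Rightarrow> complex" and y' s
    using DERIV_isCont[OF has_field_derivative_eval_mpoly[where y = y and y' = y', OF that]] .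
  \<comment> \<open>The state of the elimination after m pivots; rows outside \<open>b\<close> are
    not restricted.\<close>
  define diag where "diag m y \<longleftrightarrow> (\<forall>s<k. \<forall>t<d. s \<noteq> t \<longrightarrow> s < m \<or> t < m \<longrightarrow> y (b s, e t) = 0)"
    for m and y :: "'s \<times> 'd \<Rightarrow> complex"
  \<comment> \<open>The minimum covers d \<le> j0: there is no column j0 then, and clearing all d
    columns leaves row j0 zero.\<close>
  have diagonal: "eval_mpoly y f = 0" if "diag (min (Suc j0) d) y" for y
  proof (cases "j0 < d")
    case True
    let ?lhs = "\<lambda>c x. if fst x \<in> Rw \<and> snd x = e j0 then c * y x else y x"
    \<comment> \<open>Within the rows \<open>b\<close>, row and column j0 have only their common
      diagonal entry. Hence scaling the column equals scaling the row, up to the entries of the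
      column outside these rows, which \<open>?z c\<close> scales.\<close>
    let ?z = "\<lambda>c x. if fst x \<in> Rw - b ` {..<k} \<and> snd x = e j0 then c * y x else y x"
    have off: "y (b s, e t) = 0" if "s < k" "t < d" "s \<noteq> t" "s = j0 \<or> t = j0" for s t
      using \<open>diag _ y\<close> that True by (auto simp: diag_def)
    have z: "(\<lambda>x. if fst x = b j0 then c * ?z c x else ?z c x) = ?lhs c" for c
    proof
      fix x :: "'s \<times> 'd"
      obtain t where t: "t < d" "snd x = e t" using e_ex by metis
      show "(if fst x = b j0 then c * ?z c x else ?z c x) = ?lhs c x"
      proof (cases "fst x \<in> b ` {..<k}")
        case True
        then obtain s where s: "s < k" "fst x = b s" by auto
        then have "x = (b s, e t)" using t by (simp add: prod_eq_iff)
        then show ?thesis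
          using s t off[of s t] \<open>j0 < d\<close> j0(1) by (auto simp: b_eq e_eq b_Rw)
      next
        case False
        then show ?thesis using j0(1) by auto
      qed
    qed
    \<comment> \<open>The surplus power of c is positive, so letting c tend to 0 shows that the
      value at y is 0.\<close>
    have eq: "c ^ (lam j0 - mu j0) * eval_mpoly (?z c) f = eval_mpoly y f" if "c \<noteq> 0" for c
    proof -
      have "c ^ mu j0 * eval_mpoly y f = c ^ lam j0 * eval_mpoly (?z c) f"
        using col_scale[OF True that, of y] row_scale[OF j0(1) that, of "?z c"] z[of c] by simp
      moreover have "c ^ lam j0 = c ^ mu j0 * c ^ (lam j0 - mu j0)"
        using j0(2)[OF True] by (simp flip: power_add)
      ultimately show ?thesis using that by simp
    qed
    have "isCont (\<lambda>c. eval_mpoly (?z c) f) 0"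
      by (rule cont[where y' = "\<lambda>x. if fst x \<in> Rw - b ` {..<k} \<and> snd x = e j0 then y x else 0"])
        (auto intro!: derivative_eq_intros)
    then have "isCont (\<lambda>c. c ^ (lam j0 - mu j0) * eval_mpoly (?z c) f) 0"
      by (intro continuous_intros)
    from isCont_eq_at_zero[OF this eq] show ?thesis using j0(2)[OF True] by (simp add: power_0_left)
  next
    case False
    have y0: "y (b j0, t) = 0" for t
    proof -
      obtain t' where "t' < d" "e t' = t" using e_ex by metis
      then show ?thesis using that False j0(1) by (auto simp: diag_def)
    qed
    \<comment> \<open>Row j0 is zero, so scaling it by 2 fixes the point although it multiplies the
      value by \<open>2 ^ lam j0\<close>.\<close>
    have "(\<lambda>x. if fst x = b j0 then 2 * y x else y x) = y"
      using y0 by (auto simp: fun_eq_iff)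
    then have "eval_mpoly y f = 2 ^ lam j0 * eval_mpoly y f"
      using row_scale[OF j0(1), of 2 y] by simp
    moreover have "(2::complex) ^ lam j0 \<noteq> 1"
    proof -
      have "lam j0 \<noteq> 0" using j0(3) False by simp
      then have "(1::nat) < 2 ^ lam j0" by (intro one_less_power) auto
      then have "of_nat (2 ^ lam j0) \<noteq> (1::complex)" by (metis less_irrefl of_nat_1 of_nat_eq_iff)
      then show ?thesis by simp
    qed
    ultimately show ?thesis by simp
  qed
  have clear: "eval_mpoly y f = 0"
    if IH: "\<And>y. diag (Suc m) y \<Longrightarrow> eval_mpoly y f = 0" and m: "m < k" "m < d" and y: "diag m y"
    for m y
  proof -
    \<comment> \<open>Row m is cleared right of the pivot, the columns from n on being done. Column
      m is zero off the pivot, so within the rows \<open>b\<close> adding its multiple to column n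
      changes row m only; m < n is the direction in which f is invariant.\<close>
    have pivot_col: "eval_mpoly y f = 0"
      if "Suc m \<le> n" "n \<le> d" "diag m y" "y (b m, e m) \<noteq> 0"
        "\<forall>s<k. s \<noteq> m \<longrightarrow> y (b s, e m) = 0" "\<forall>t<d. n \<le> t \<longrightarrow> y (b m, e t) = 0" for n y
      using that
    proof (induction n arbitrary: y rule: dec_induct)
      case base
      have "diag (Suc m) y"
        unfolding diag_def
      proof (intro allI impI)
        fix s t assume "s < k" "t < d" "s \<noteq> t" "s < Suc m \<or> t < Suc m"
        then consider "s < m \<or> t < m" | "t = m" "s \<noteq> m" | "s = m" "Suc m \<le> t" by linarith
        then show "y (b s, e t) = 0"
        proof cases
          case 1
          then show ?thesis using base.prems(2) \<open>s < k\<close> \<open>t < d\<close> \<open>s \<noteq> t\<close> unfolding diag_def by blast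
        next
          case 2
          then show ?thesis using base.prems(4) \<open>s < k\<close> by simp
        next
          case 3
          then show ?thesis using base.prems(5) \<open>t < d\<close> by simp
        qed
      qed
      then show ?case by (rule IH)
    next
      case (step n)
      define c where "c = - y (b m, e n) / y (b m, e m)"
      define z where "z = (\<lambda>x. if fst x \<in> Rw \<and> snd x = e n then y x + c * y (fst x, e m) else y x)"
      have zb: "z (b s, e t) = (if t = n then y (b s, e n) + c * y (b s, e m) else y (b s, e t))"
        if "s < k" "t < d" for s t
        using that step.hyps step.prems(1) m by (auto simp: z_def b_Rw e_eq)
      have dg: "y (b s, e t) = 0" if "s < k" "t < d" "s \<noteq> t" "s < m \<or> t < m" for s t
        using step.prems(2) that unfolding diag_def by blast
      have "eval_mpoly z f = 0"
      proof (rule step.IH)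
        show "diag m z"
          unfolding diag_def
        proof (intro allI impI)
          fix s t assume st: "s < k" "t < d" "s \<noteq> t" "s < m \<or> t < m"
          show "z (b s, e t) = 0"
          proof (cases "t = n")
            case True
            with st step.hyps have "s < m" by linarith
            with st m step.hyps True show ?thesis by (simp add: zb dg)
          next
            case False
            with st show ?thesis by (simp add: zb dg)
          qed
        qed
        show "\<forall>t<d. n \<le> t \<longrightarrow> z (b m, e t) = 0"
        proof (intro allI impI)
          fix t assume t: "t < d" "n \<le> t"
          show "z (b m, e t) = 0"
          proof (cases "t = n")
            case True
            with t m step.prems(3) show ?thesis by (simp add: zb c_def)
          next
            case False
            with t m step.prems(5) show ?thesis by (simp add: zb)
          qed
        qed
      qed (use step.hyps step.prems m in \<open>auto simp: zb\<close>)
      then show ?case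
        using col[of m n y c] step.hyps step.prems by (simp add: z_def)
    qed
    \<comment> \<open>Column m is cleared below the pivot before row m is treated. Row n also
      changes right of column m, but only \<open>diag m\<close> has to survive.\<close>
    have pivot_row: "eval_mpoly y f = 0"
      if "Suc m \<le> n" "n \<le> k" "diag m y" "y (b m, e m) \<noteq> 0"
        "\<forall>s<k. n \<le> s \<longrightarrow> y (b s, e m) = 0" for n y
      using that
    proof (induction n arbitrary: y rule: dec_induct)
      case base
      show ?case
      proof (rule pivot_col[of d])
        show "\<forall>s<k. s \<noteq> m \<longrightarrow> y (b s, e m) = 0"
        proof (intro allI impI)
          fix s assume s: "s < k" "s \<noteq> m"
          show "y (b s, e m) = 0"
          proof (cases "s < m")
            case True
            with s m base.prems(2) show ?thesis unfolding diag_def by blast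
          next
            case False
            with s base.prems(4) show ?thesis by simp
          qed
        qed
      qed (use base.prems m in simp_all)
    next
      case (step n)
      define c where "c = - y (b n, e m) / y (b m, e m)"
      define z where "z = (\<lambda>x. if fst x = b n then y x + c * y (b m, snd x) else y x)"
      have zb: "z (b s, e t) = (if s = n then y (b n, e t) + c * y (b m, e t) else y (b s, e t))"
        if "s < k" "t < d" for s t
        using that step.hyps step.prems(1) m by (auto simp: z_def b_eq)
      have dg: "y (b s, e t) = 0" if "s < k" "t < d" "s \<noteq> t" "s < m \<or> t < m" for s t
        using step.prems(2) that unfolding diag_def by blast
      have "eval_mpoly z f = 0"
      proof (rule step.IH)
        show "diag m z"
          unfolding diag_def
        proof (intro allI impI)
          fix s t assume st: "s < k" "t < d" "s \<noteq> t" "s < m \<or> t < m"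
          show "z (b s, e t) = 0"
          proof (cases "s = n")
            case True
            with st step.hyps have "t < m" by linarith
            with st m step.hyps True show ?thesis by (simp add: zb dg)
          next
            case False
            with st show ?thesis by (simp add: zb dg)
          qed
        qed
        show "\<forall>s<k. n \<le> s \<longrightarrow> z (b s, e m) = 0"
        proof (intro allI impI)
          fix s assume s: "s < k" "n \<le> s"
          show "z (b s, e m) = 0"
          proof (cases "s = n")
            case True
            with s m step.prems(3) show ?thesis by (simp add: zb c_def)
          next
            case False
            with s m step.prems(4) show ?thesis by (simp add: zb)
          qed
        qed
      qed (use step.hyps step.prems m in \<open>auto simp: zb\<close>)
      then show ?case
        using row[of m n y c] step.hyps step.prems by (simp add: z_def)
    qed
    \<comment> \<open>The pivot becomes a parameter because it may be 0 in y; the value there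
      follows by continuity.\<close>
    have nz: "eval_mpoly (y((b m, e m) := c)) f = 0" if "c \<noteq> 0" for c
    proof (rule pivot_row[of k])
      show "diag m (y((b m, e m) := c))"
        using y m by (auto simp: diag_def b_eq e_eq)
    qed (use m that in auto)
    show ?thesis
    proof (cases "y (b m, e m) = 0")
      case True
      have "isCont (\<lambda>c. eval_mpoly (y((b m, e m) := c)) f) 0"
      proof (rule cont)
        show "((\<lambda>c. (y((b m, e m) := c)) x) has_field_derivative of_bool (x = (b m, e m))) (at c)"
          for c x by (cases "x = (b m, e m)") simp_all
      qed
      from isCont_eq_at_zero[OF this nz] True show ?thesis
        by (simp add: fun_upd_idem)
    next
      case False
      from nz[OF this] show ?thesis by simp
    qed
  qed
  have from_diag: "eval_mpoly y f = 0" if "n \<le> min (Suc j0) d" "diag n y" for n y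
    using that
  proof (induction n arbitrary: y rule: inc_induct)
    case base
    then show ?case by (rule diagonal)
  next
    case (step n)
    show ?case
      by (rule clear[of n]) (use step.hyps step.prems step.IH j0(1) in simp_all)
  qed
  have "eval_mpoly y f = 0" for y
    by (rule from_diag[of 0]) (simp_all add: diag_def)
  then show ?thesis by (rule eval_mpoly_eq_zero_imp_zero)
qed

section \<open>Fermions and superpolarizations\<close>

instance symbol :: (finite, finite, finite) finite
proof
  have "x \<in> range Pos \<union> range Neg \<union> range Proper" for x :: "('a, 'b, 'c) symbol"
    by (cases x) auto
  then have "(UNIV :: ('a, 'b, 'c) symbol set) = range Pos \<union> range Neg \<union> range Proper"
    by blast
  then show "finite (UNIV :: ('a, 'b, 'c) symbol set)"
    by (metis finite_UnI finite_imageI finite)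
qed

section \<open>The exterior algebra of the odd variables\<close>

definition enum_index :: "'x::finite \<Rightarrow> nat" where
  "enum_index = (SOME f. inj f)"

lemma inj_enum_index: "inj (enum_index :: 'x::finite \<Rightarrow> nat)"
proof -
  have "\<exists>f :: 'x \<Rightarrow> nat. inj f"
    using finite_imp_inj_to_nat_seg[of "UNIV :: 'x set"] by auto
  then show ?thesis unfolding enum_index_def by (rule someI_ex)
qed

text \<open>The sign of moving x to its place in the sorted monomial A; \<open>enum_index\<close>
  fixes an arbitrary order of the odd variables.\<close>

definition koszul_sign :: "'x::finite \<Rightarrow> 'x set \<Rightarrow> 'r::comm_ring_1" where
  "koszul_sign x A = (-1) ^ card {y \<in> A. enum_index y < enum_index x}"

text \<open>Left multiplication by the odd variable x, on the coefficients of an element of the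
  exterior algebra. With \<open>annihilation\<close>, the left derivative, it satisfies the
  canonical anticommutation relations.\<close>

definition creation :: "'x::finite \<Rightarrow> ('x set \<Rightarrow> 'r::comm_ring_1) \<Rightarrow> 'x set \<Rightarrow> 'r" where
  "creation x F = (\<lambda>A. if x \<in> A then koszul_sign x A * F (A - {x}) else 0)"

definition annihilation :: "'x::finite \<Rightarrow> ('x set \<Rightarrow> 'r::comm_ring_1) \<Rightarrow> 'x set \<Rightarrow> 'r" where
  "annihilation x F = (\<lambda>A. if x \<in> A then 0 else koszul_sign x A * F (insert x A))"

lemma koszul_sign_square [simp]: "koszul_sign x A * (koszul_sign x A * c) = c"
  by (simp add: koszul_sign_def flip: mult.assoc power_add)

lemma koszul_sign_insert_self [simp]:
  "koszul_sign x (insert x A) = koszul_sign x A" "koszul_sign x (A - {x}) = koszul_sign x A"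
proof -
  have "{y \<in> insert x A. enum_index y < enum_index x} = {y \<in> A. enum_index y < enum_index x}"
    "{y \<in> A - {x}. enum_index y < enum_index x} = {y \<in> A. enum_index y < enum_index x}"
    by auto
  then show "koszul_sign x (insert x A) = koszul_sign x A" "koszul_sign x (A - {x}) = koszul_sign x A"
    by (simp_all add: koszul_sign_def)
qed

lemma koszul_sign_insert:
  assumes "y \<notin> A"
  shows "koszul_sign x (insert y A) =
    (if enum_index y < enum_index x then - koszul_sign x A else koszul_sign x A)"
proof -
  have "{z \<in> insert y A. enum_index z < enum_index x} =
      (if enum_index y < enum_index x then insert y {z \<in> A. enum_index z < enum_index x}
       else {z \<in> A. enum_index z < enum_index x})"
    by auto
  with assms show ?thesis by (simp add: koszul_sign_def)
qed

lemma koszul_sign_remove: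
  assumes "y \<in> A"
  shows "koszul_sign x (A - {y}) =
    (if enum_index y < enum_index x then - koszul_sign x A else koszul_sign x A)"
proof -
  have "insert y (A - {y}) = A" using assms by auto
  then have "koszul_sign x A =
    (if enum_index y < enum_index x then - koszul_sign x (A - {y}) else koszul_sign x (A - {y}) :: 'b)"
    using koszul_sign_insert[of y "A - {y}" x] by simp
  then show ?thesis by simp
qed

lemma enum_index_less_asym: "x \<noteq> y \<Longrightarrow> enum_index y < enum_index x \<longleftrightarrow> \<not> enum_index x < enum_index y"
  using inj_enum_index by (metis injD linorder_neq_iff not_less_iff_gr_or_eq)

text \<open>Of two distinct variables exactly one precedes the other, so exactly one of the two
  orders picks up an additional sign. For equal variables both sides are 0.\<close>

lemma creation_creation: "creation x (creation y F) = - creation y (creation x F)"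
proof (cases "x = y")
  case True
  then show ?thesis by (simp add: creation_def fun_eq_iff)
next
  case False
  have *: "A - {x} - {y} = A - {y} - {x}" for A :: "'a set" by auto
  show ?thesis
    using False enum_index_less_asym[OF False]
    by (auto simp: creation_def fun_eq_iff koszul_sign_remove * mult.left_commute)
qed

lemma annihilation_annihilation:
  "annihilation x (annihilation y F) = - annihilation y (annihilation x F)"
proof (cases "x = y")
  case True
  then show ?thesis by (simp add: annihilation_def fun_eq_iff)
next
  case False
  show ?thesis
    using False enum_index_less_asym[OF False]
    by (auto simp: annihilation_def fun_eq_iff koszul_sign_insert insert_commute mult.left_commute)
qed

lemma annihilation_creation:
  "annihilation x (creation y F) = (if x = y then F else 0) - creation y (annihilation x F)"
proof (cases "x = y")
  case True
  then show ?thesis by (simp add: creation_def annihilation_def fun_eq_iff insert_absorb)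
next
  case False
  have *: "insert x A - {y} = insert x (A - {y})" for A :: "'a set" using False by auto
  show ?thesis
    using False enum_index_less_asym[OF False]
    by (auto simp: creation_def annihilation_def fun_eq_iff koszul_sign_insert koszul_sign_remove *
        mult.left_commute)
qed

lemma koszul_sign_additive:
  assumes "h 0 = 0" and "\<And>c. h (- c) = - h c"
  shows "h (koszul_sign x A * c) = koszul_sign x A * h c"
proof -
  have "(koszul_sign x A :: 'a) = 1 \<and> (koszul_sign x A :: 'b) = 1 \<or>
      (koszul_sign x A :: 'a) = - 1 \<and> (koszul_sign x A :: 'b) = - 1"
    by (auto simp: koszul_sign_def minus_one_power_iff)
  with assms(2) show ?thesis by auto
qed

text \<open>Meant for h the multiplication by, or differentiation in, an even variable: these act on
  the coefficients and hence commute with the odd operators.\<close>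

lemma creation_map:
  assumes "h 0 = 0" and "\<And>c. h (- c) = - h c"
  shows "creation x (\<lambda>A. h (F A)) = (\<lambda>A. h (creation x F A))"
  using assms by (simp add: creation_def fun_eq_iff koszul_sign_additive[of h])

lemma annihilation_map:
  assumes "h 0 = 0" and "\<And>c. h (- c) = - h c"
  shows "annihilation x (\<lambda>A. h (F A)) = (\<lambda>A. h (annihilation x F A))"
  using assms by (simp add: annihilation_def fun_eq_iff koszul_sign_additive[of h])

text \<open>\<open>\<complex>[M\<^bsub>m\<^sub>0|m\<^sub>1+n,d\<^esub>]\<close> is free over the polynomials in the even variables \<open>(a|t)\<close> with basis
  the monomials in the odd variables \<open>(\<alpha>|t)\<close>, i.e. the subsets of \<open>'p \<times> 'd\<close>. The even variables are
  drawn from the whole alphabet; those at positive symbols are never used.\<close>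

type_synonym ('p, 'q, 'l, 'd) superpoly = "('p \<times> 'd) set \<Rightarrow> (('p, 'q, 'l) symbol, 'd) mpoly"

fun supervar :: "('p::finite, 'q, 'l) symbol \<Rightarrow> 'd::finite
    \<Rightarrow> ('p, 'q, 'l, 'd) superpoly \<Rightarrow> ('p, 'q, 'l, 'd) superpoly" where
  "supervar (Pos p) t F = creation (p, t) F"
| "supervar (Neg q) t F = (\<lambda>A. var (Neg q) t * F A)"
| "supervar (Proper i) t F = (\<lambda>A. var (Proper i) t * F A)"

fun superderiv :: "('p::finite, 'q, 'l) symbol \<Rightarrow> 'd::finite
    \<Rightarrow> ('p, 'q, 'l, 'd) superpoly \<Rightarrow> ('p, 'q, 'l, 'd) superpoly" where
  "superderiv (Pos p) t F = annihilation (p, t) F"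
| "superderiv (Neg q) t F = (\<lambda>A. partial_deriv (Neg q) t (F A))"
| "superderiv (Proper i) t F = (\<lambda>A. partial_deriv (Proper i) t (F A))"

lemma partial_deriv_uminus: "partial_deriv i t (- f) = - partial_deriv i t f"
  using partial_deriv_add[of i t f "- f"] by (simp add: eq_neg_iff_add_eq_0 add.commute)

text \<open>The parity of \<open>supervar a t\<close> is \<open>parity a + 1\<close>, the columns being odd.\<close>

definition supersign :: "'a::graded \<Rightarrow> 'a \<Rightarrow> 'r::comm_ring_1" where
  "supersign a b = (-1) ^ (Suc (parity a) * Suc (parity b))"

lemma supersign_commute: "supersign a b = supersign b a"
  by (simp add: supersign_def mult.commute)

lemma supervar_add: "supervar a t (F + G) = supervar a t F + supervar a t G"
  by (cases a) (auto simp: creation_def fun_eq_iff distrib_left)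

lemma superderiv_add: "superderiv a t (F + G) = superderiv a t F + superderiv a t G"
  by (cases a) (auto simp: annihilation_def fun_eq_iff distrib_left partial_deriv_add)

lemma supervar_uminus: "supervar a t (- F) = - supervar a t F"
  by (cases a) (auto simp: creation_def fun_eq_iff)

lemma superderiv_uminus: "superderiv a t (- F) = - superderiv a t F"
  by (cases a) (auto simp: annihilation_def fun_eq_iff partial_deriv_uminus)

lemma supervar_zero [simp]: "supervar a t 0 = 0"
  using supervar_add[of a t 0 0] by simp

lemma superderiv_zero [simp]: "superderiv a t 0 = 0"
  using superderiv_add[of a t 0 0] by simp

lemma supervar_sum: "supervar a t (\<Sum>i\<in>I. F i) = (\<Sum>i\<in>I. supervar a t (F i))"
  by (simp only: comp_def flip: sum_comp_morphism[of "supervar a t", OF supervar_zero supervar_add])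

lemma superderiv_sum: "superderiv a t (\<Sum>i\<in>I. F i) = (\<Sum>i\<in>I. superderiv a t (F i))"
  by (simp only: comp_def flip: sum_comp_morphism[of "superderiv a t", OF superderiv_zero superderiv_add])

lemma supervar_supersign: "supervar a t (supersign b c * F) = supersign b c * supervar a t F"
  by (simp add: supersign_def minus_one_power_iff supervar_uminus)

lemma supervar_supervar:
  "supervar a t (supervar c u F) = supersign a c * supervar c u (supervar a t F)"
proof (cases a; cases c)
  fix p p' assume "a = Pos p" "c = Pos p'"
  then show ?thesis
    using creation_creation[of "(p, t)" "(p', u)" F] by (simp add: supersign_def)
qed (simp_all add: supersign_def creation_map mult.left_commute)

lemma superderiv_superderiv:
  "superderiv a t (superderiv c u F) = supersign a c * superderiv c u (superderiv a t F)"
proof (cases a; cases c)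
  fix p p' assume "a = Pos p" "c = Pos p'"
  then show ?thesis
    using annihilation_annihilation[of "(p, t)" "(p', u)" F] by (simp add: supersign_def)
qed (simp_all add: supersign_def annihilation_map partial_deriv_uminus partial_deriv_commute)

lemma superderiv_supervar:
  "superderiv a t (supervar c u F) =
     (if a = c \<and> t = u then F else 0) + supersign a c * supervar c u (superderiv a t F)"
proof (cases a; cases c)
  fix p p' assume "a = Pos p" "c = Pos p'"
  then show ?thesis
    using annihilation_creation[of "(p, t)" "(p', u)" F] by (simp add: supersign_def)
qed (auto simp: supersign_def creation_map annihilation_map partial_deriv_uminus
    partial_deriv_var_mult fun_eq_iff)

section \<open>Superpolarizations and column operators\<close>

definition superpol :: "('p::finite, 'q, 'l) symbol \<Rightarrow> ('p, 'q, 'l) symbol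
    \<Rightarrow> ('p, 'q, 'l, 'd::finite) superpoly \<Rightarrow> ('p, 'q, 'l, 'd) superpoly" where
  "superpol a b F = (\<Sum>t\<in>UNIV. supervar a t (superderiv b t F))"

text \<open>The polarization of columns instead of rows. The sum runs over the whole alphabet, odd
  rows included, to make it commute with every superpolarization.\<close>

definition colpol :: "'d \<Rightarrow> 'd
    \<Rightarrow> ('p::finite, 'q::finite, 'l::finite, 'd::finite) superpoly \<Rightarrow> ('p, 'q, 'l, 'd) superpoly" where
  "colpol t u F = (\<Sum>a\<in>UNIV. supervar a t (superderiv a u F))"

lemma superpol_superpol:
  "superpol a b (superpol c d F) = (if b = c then superpol a d F else 0) +
     supersign b c * (\<Sum>t\<in>UNIV. \<Sum>u\<in>UNIV. supervar a t (supervar c u (superderiv b t (superderiv d u F))))"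
  by (simp add: superpol_def superderiv_sum supervar_sum superderiv_supervar supervar_add
      supervar_supersign sum.distrib sum_distrib_left if_distrib[of "supervar _ _"] sum.delta
      cong: if_cong)

text \<open>With all derivatives moved to the right, each product is a contraction plus a double
  sum. The two double sums agree up to the sign of the superbracket, so only the contractions
  survive.\<close>

lemma superpol_commutator:
  fixes F :: "('p::finite, 'q, 'l, 'd::finite) superpoly"
  shows "superpol a b (superpol c d F) =
     (if b = c then superpol a d F else 0)
     - (-1) ^ ((parity a + parity b) * (parity c + parity d)) * (if a = d then superpol c b F else 0)
     + (-1) ^ ((parity a + parity b) * (parity c + parity d)) * superpol c d (superpol a b F)"
proof -
  let ?s = "(-1) ^ ((parity a + parity b) * (parity c + parity d)) :: ('p, 'q, 'l, 'd) superpoly"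
  let ?S = "\<lambda>a b c d. \<Sum>t\<in>UNIV. \<Sum>u\<in>UNIV. supervar a t (supervar c u (superderiv b t (superderiv d u F)))"
  have "?S c d a b = (\<Sum>u\<in>UNIV. \<Sum>t\<in>UNIV. supervar c t (supervar a u (superderiv d t (superderiv b u F))))"
    by (rule sum.swap)
  also have "\<dots> = supersign c a * supersign d b * ?S a b c d"
    unfolding sum_distrib_left
    by (intro sum.cong refl)
      (subst supervar_supervar, subst superderiv_superderiv,
       simp add: supervar_supersign mult.assoc)
  finally have S: "?S c d a b = supersign c a * supersign d b * ?S a b c d" .
  \<comment> \<open>Write a, b, c, d for the parities and x' = x + 1. Modulo 2, a'c' + d'b' + d'a' +
    b'c' = (a' + b')(c' + d') = (a + b)(c + d).\<close>
  have sign: "supersign b c = ?s * (supersign d a * (supersign c a * supersign d b))"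
    by (cases a; cases b; cases c; cases d) (simp_all add: supersign_def)
  have "?s * superpol c d (superpol a b F)
      = ?s * (if a = d then superpol c b F else 0) + supersign b c * ?S a b c d"
    unfolding superpol_superpol[of c d] S sign by (auto simp: distrib_left mult.assoc)
  then show ?thesis
    unfolding superpol_superpol[of a b] by simp
qed

lemma superpol_add: "superpol a b (F + G) = superpol a b F + superpol a b G"
  by (simp add: superpol_def superderiv_add supervar_add sum.distrib)

lemma sum_delta_pair:
  fixes f :: "'a::finite \<Rightarrow> 'b::finite \<Rightarrow> 'c::comm_monoid_add"
  shows "(\<Sum>x\<in>UNIV. \<Sum>y\<in>UNIV. if x = a \<and> b = y then f x y else 0) = f a b"
    and "(\<Sum>x\<in>UNIV. \<Sum>y\<in>UNIV. if b = y \<and> x = a then f x y else 0) = f a b"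
proof -
  have "(\<Sum>x\<in>UNIV. \<Sum>y\<in>UNIV. if x = a \<and> b = y then f x y else 0)
      = (\<Sum>x\<in>UNIV. if x = a then f x b else 0)"
    by (intro sum.cong refl) (simp add: sum.delta')
  then show "(\<Sum>x\<in>UNIV. \<Sum>y\<in>UNIV. if x = a \<and> b = y then f x y else 0) = f a b"
    by (simp add: sum.delta)
  then show "(\<Sum>x\<in>UNIV. \<Sum>y\<in>UNIV. if b = y \<and> x = a then f x y else 0) = f a b"
    by (simp add: conj_commute)
qed

text \<open>Operations on the two indices commute: either order gives the contraction
  \<open>supervar a t (superderiv b u F)\<close> and the same double sum with derivatives on the
  right.\<close>

lemma colpol_superpol: "colpol t u (superpol a b F) = superpol a b (colpol t u F)"
proof -
  have "colpol t u (superpol a b F) = supervar a t (superderiv b u F) +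
      (\<Sum>c\<in>UNIV. \<Sum>w\<in>UNIV. supersign c a * supervar c t (supervar a w (superderiv c u (superderiv b w F))))"
    by (simp add: colpol_def superpol_def superderiv_sum supervar_sum superderiv_supervar supervar_add
      supervar_supersign sum.distrib if_distrib[of "supervar _ _"] sum_delta_pair cong: if_cong)
  also have "(\<Sum>c\<in>UNIV. \<Sum>w\<in>UNIV. supersign c a * supervar c t (supervar a w (superderiv c u (superderiv b w F))))
      = (\<Sum>w\<in>UNIV. \<Sum>c\<in>UNIV. supersign b c * supervar a w (supervar c t (superderiv b w (superderiv c u F))))"
    by (subst sum.swap, intro sum.cong refl)
      (subst supervar_supervar, subst superderiv_superderiv,
       simp add: supervar_supersign supersign_commute)
  also have "supervar a t (superderiv b u F) + \<dots> = superpol a b (colpol t u F)"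
    by (simp add: colpol_def superpol_def superderiv_sum supervar_sum superderiv_supervar supervar_add
      supervar_supersign sum.distrib if_distrib[of "supervar _ _"] sum_delta_pair cong: if_cong)
  finally show ?thesis .
qed

section \<open>Representation of the enveloping superalgebra\<close>

text \<open>The induction method eta-expands, after which these rules would break up sums of
  superpolynomials.\<close>

lemmas pointwise = plus_fun_apply zero_fun_apply one_fun_apply times_fun_apply minus_apply uminus_apply
declare pointwise [simp del]

text \<open>The product on coefficient functions is pointwise, so a scalar is a constant function,
  not the element c of the exterior algebra.\<close>

definition scalar :: "complex \<Rightarrow> ('p, 'q, 'l, 'd) superpoly" where
  "scalar c = (\<lambda>_. const c)"

lemma scalar_simps [simp]: "scalar 0 = 0" "scalar 1 = 1"
  by (simp_all add: scalar_def fun_eq_iff pointwise) (simp add: const_def)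

lemma scalar_add: "scalar (c + d) = scalar c + scalar d"
  by (simp add: scalar_def fun_eq_iff pointwise const_add)

lemma scalar_mult: "scalar (c * d) = scalar c * scalar d"
  by (simp add: scalar_def fun_eq_iff pointwise const_mult)

lemma supervar_scalar: "supervar a t (scalar c * F) = scalar c * supervar a t F"
  by (cases a) (simp_all add: scalar_def creation_def fun_eq_iff pointwise mult.left_commute)

lemma superderiv_scalar: "superderiv a t (scalar c * F) = scalar c * superderiv a t F"
  by (cases a)
    (simp_all add: scalar_def annihilation_def fun_eq_iff pointwise mult.left_commute partial_deriv_const_mult)

lemma superpol_scalar: "superpol a b (scalar c * F) = scalar c * superpol a b F"
  by (simp add: superpol_def superderiv_scalar supervar_scalar sum_distrib_left)

lemma superpol_zero [simp]: "superpol a b 0 = 0"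
  by (simp add: superpol_def)

definition superpols :: "(('p::finite, 'q, 'l) symbol \<times> ('p, 'q, 'l) symbol) list
    \<Rightarrow> ('p, 'q, 'l, 'd::finite) superpoly \<Rightarrow> ('p, 'q, 'l, 'd) superpoly" where
  "superpols = foldr (\<lambda>(a, b). superpol a b)"

lemma superpols_simps [simp]:
  "superpols [] F = F" "superpols ((a, b) # ps) F = superpol a b (superpols ps F)"
  "superpols (ps @ qs) F = superpols ps (superpols qs F)"
  by (simp_all add: superpols_def)

lemma superpols_add: "superpols ps (F + G) = superpols ps F + superpols ps G"
  by (induction ps) (auto simp: superpol_add)

lemma superpols_scalar: "superpols ps (scalar c * F) = scalar c * superpols ps F"
  by (induction ps) (auto simp: superpol_scalar)

lemma superpols_zero [simp]: "superpols ps 0 = 0"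
  by (induction ps) auto

definition tensor_superaction :: "('p::finite, 'q, 'l) symbol tensor
    \<Rightarrow> ('p, 'q, 'l, 'd::finite) superpoly \<Rightarrow> ('p, 'q, 'l, 'd) superpoly" where
  "tensor_superaction x F =
     (\<Sum>w\<in>Poly_Mapping.keys x. scalar (Poly_Mapping.lookup x w) * superpols (letters w) F)"

lemma tensor_superaction_add_left:
  "tensor_superaction (x + y) F = tensor_superaction x F + tensor_superaction y F"
  unfolding tensor_superaction_def by (rule sum_keys_add) (simp_all add: scalar_add distrib_right)

lemma tensor_superaction_single:
  "tensor_superaction (Poly_Mapping.single w c) F = scalar c * superpols (letters w) F"
  unfolding tensor_superaction_def by (rule sum_keys_single) simp

lemma tensor_superaction_zero_left [simp]: "tensor_superaction 0 F = 0"
  by (simp add: tensor_superaction_def)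

lemma tensor_superaction_add_right:
  "tensor_superaction x (F + G) = tensor_superaction x F + tensor_superaction x G"
  by (simp add: tensor_superaction_def superpols_add distrib_left sum.distrib)

lemma tensor_superaction_zero_right [simp]: "tensor_superaction x 0 = 0"
  by (simp add: tensor_superaction_def)

lemma tensor_superaction_uminus_left: "tensor_superaction (- x) F = - tensor_superaction x F"
  using tensor_superaction_add_left[of x "- x" F] by (simp add: eq_neg_iff_add_eq_0 add.commute)

lemma tensor_superaction_diff_left:
  "tensor_superaction (x - y) F = tensor_superaction x F - tensor_superaction y F"
  using tensor_superaction_add_left[of x "- y" F] by (simp add: tensor_superaction_uminus_left)

lemma tensor_superaction_mult:
  "tensor_superaction (x * y) F = tensor_superaction x (tensor_superaction y F)"
proof (induction x rule: poly_mapping_add_induct)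
  case (single u c)
  show ?case
  proof (induction y rule: poly_mapping_add_induct)
    case (single v d)
    show ?case
      by (simp add: mult_single tensor_superaction_single plus_word_def superpols_scalar
          scalar_mult mult.assoc)
  qed (simp_all add: distrib_left tensor_superaction_add_left tensor_superaction_add_right)
qed (simp_all add: distrib_right tensor_superaction_add_left)

lemma tensor_superaction_gen: "tensor_superaction (gen a b) F = superpol a b F"
  by (simp add: gen_def tensor_superaction_single)

lemma tensor_superaction_neg_one_power_mult:
  "tensor_superaction ((-1) ^ n * x) F = (-1) ^ n * tensor_superaction x F"
  by (simp add: minus_one_power_iff tensor_superaction_uminus_left)

lemma tensor_superaction_relator: "tensor_superaction (relator a b c d) F = 0"
  unfolding relator_def superbracket_def tensor_superaction_diff_left
    tensor_superaction_neg_one_power_mult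
  by (simp add: tensor_superaction_mult tensor_superaction_gen superpol_commutator[of a b c d]
      if_distrib[of "\<lambda>x. tensor_superaction x F"] cong: if_cong)

lemma tensor_superaction_relator_ideal: "x \<in> relator_ideal \<Longrightarrow> tensor_superaction x F = 0"
  by (induction rule: relator_ideal.induct)
    (simp_all add: tensor_superaction_add_left tensor_superaction_mult tensor_superaction_relator)

lift_definition superaction :: "('p::finite, 'q, 'l) symbol uea
    \<Rightarrow> ('p, 'q, 'l, 'd::finite) superpoly \<Rightarrow> ('p, 'q, 'l, 'd) superpoly"
  is tensor_superaction
  using tensor_superaction_relator_ideal by (fastforce simp: tensor_superaction_diff_left fun_eq_iff pointwise)

lemma superaction_zero_left [simp]: "superaction 0 F = 0"
  by transfer simp

lemma superaction_zero_right [simp]: "superaction x 0 = 0"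
  by transfer simp

lemma superaction_one [simp]: "superaction 1 F = F"
  by transfer (simp add: tensor_superaction_single zero_word_def flip: single_one)

lemma superaction_add: "superaction (x + y) F = superaction x F + superaction y F"
  by transfer (rule tensor_superaction_add_left)

lemma superaction_diff: "superaction (x - y) F = superaction x F - superaction y F"
  by transfer (rule tensor_superaction_diff_left)

lemma superaction_mult: "superaction (x * y) F = superaction x (superaction y F)"
  by transfer (rule tensor_superaction_mult)

lemma superaction_E: "superaction (E a b) F = superpol a b F"
  by transfer (rule tensor_superaction_gen)

lemma superaction_e_word: "superaction (e_word ps) F = superpols ps F"
  by (induction ps) (auto simp: e_word_def superaction_mult superaction_E)

subsection \<open>Weights\<close>

text \<open>At a positive symbol only the odd variables are counted, because these are the ones that
  \<open>superderiv\<close> sees there.\<close>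

fun symbol_degree :: "('p, 'q, 'l) symbol \<Rightarrow> ('p \<times> 'd) set
    \<Rightarrow> (('p, 'q, 'l) symbol \<times> 'd::finite \<Rightarrow>\<^sub>0 nat) \<Rightarrow> nat" where
  "symbol_degree (Pos p) A m = card {t. (p, t) \<in> A}"
| "symbol_degree (Neg q) A m = (\<Sum>t\<in>UNIV. Poly_Mapping.lookup m (Neg q, t))"
| "symbol_degree (Proper i) A m = (\<Sum>t\<in>UNIV. Poly_Mapping.lookup m (Proper i, t))"

lemma lookup_of_nat_mult:
  "Poly_Mapping.lookup (of_nat n * f) m = of_nat n * Poly_Mapping.lookup (f :: ('l, 'd) mpoly) m"
  by (induction n) (simp_all add: distrib_right lookup_add)

lemma lookup_const_mult:
  "Poly_Mapping.lookup (const c * f) m = c * Poly_Mapping.lookup (f :: ('l, 'd) mpoly) m"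
  by (induction f rule: poly_mapping_add_induct)
    (simp_all add: const_def mult_single lookup_single when_def distrib_left lookup_add)

lemma lookup_var_mult_partial_deriv:
  "Poly_Mapping.lookup (var i t * partial_deriv i t f) m
    = of_nat (Poly_Mapping.lookup m (i, t)) * Poly_Mapping.lookup f m"
proof (induction f rule: poly_mapping_add_induct)
  case (single k c)
  let ?e = "Poly_Mapping.single (i, t) (1::nat)"
  show ?case
  proof (cases "Poly_Mapping.lookup k (i, t) = 0")
    case False
    then have "?e + (k - ?e) = k"
      by (intro poly_mapping_eqI) (auto simp: lookup_add lookup_minus lookup_single when_def)
    then show ?thesis
      by (simp add: var_def partial_deriv_single mult_single lookup_single when_def)
  qed (auto simp: partial_deriv_single lookup_single when_def)
qed (simp_all add: partial_deriv_add distrib_left lookup_add)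

lemma fun_sum_apply: "(\<Sum>i\<in>I. f i) x = (\<Sum>i\<in>I. f i x)"
  by (induction I rule: infinite_finite_induct) (simp_all add: pointwise)

text \<open>\<open>superpol a a\<close> is the Euler operator of row a, hence diagonal in the
  monomials.\<close>

lemma lookup_superpol_diag:
  "Poly_Mapping.lookup (superpol a a F A) m
    = of_nat (symbol_degree a A m) * Poly_Mapping.lookup (F A) m"
proof (cases a)
  case (Pos p)
  have "superpol a a F A = (\<Sum>t\<in>UNIV. if (p, t) \<in> A then F A else 0)"
    by (auto simp: superpol_def Pos fun_sum_apply creation_def annihilation_def insert_absorb
        intro!: sum.cong)
  also have "\<dots> = of_nat (card {t. (p, t) \<in> A}) * F A"
    by (simp flip: sum.inter_filter)
  finally show ?thesis by (simp add: Pos lookup_of_nat_mult)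
qed (simp_all add: superpol_def fun_sum_apply lookup_sum lookup_var_mult_partial_deriv sum_distrib_right)

lemma const_minus_one: "const (- 1) = - 1"
  by (metis const_def single_one single_uminus)

lemma scalar_minus_one: "scalar (- 1) = - 1"
  by (simp add: scalar_def fun_eq_iff pointwise const_minus_one)

lemma superpol_diag_superpol:
  "superpol a a (superpol c d F) =
     superpol c d (superpol a a F) + scalar (of_bool (a = c) - of_bool (a = d)) * superpol c d F"
proof -
  have "superpol a a (superpol c d F) = (if a = c then superpol a d F else 0)
      - (if a = d then superpol c a F else 0) + superpol c d (superpol a a F)"
    using superpol_commutator[of a a c d F] by (simp add: power_mult power_add flip: mult_2)
  then show ?thesis by (auto simp: algebra_simps scalar_minus_one)
qed

text \<open>Each factor raises the weight of its first index by one and lowers that of its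
  second.\<close>

lemma superpol_diag_superpols:
  assumes "superpol a a F = scalar k * F"
  shows "superpol a a (superpols ps F) =
    scalar (k + of_nat (count_list (map fst ps) a) - of_nat (count_list (map snd ps) a)) * superpols ps F"
proof (induction ps)
  case Nil
  show ?case using assms by simp
next
  case (Cons p ps)
  obtain c d where p: "p = (c, d)" by fastforce
  show ?case
    by (simp add: p superpol_diag_superpol Cons.IH superpol_scalar flip: distrib_right scalar_add)
      (auto simp: algebra_simps)
qed

lemma weight_nonneg:
  assumes "superpol a a F = scalar (of_int k) * F" and "k < 0"
  shows "F = 0"
proof (intro ext poly_mapping_eqI)
  fix A m
  have "of_nat (symbol_degree a A m) * Poly_Mapping.lookup (F A) m = of_int k * Poly_Mapping.lookup (F A) m"
    using arg_cong[OF assms(1), of "\<lambda>G. Poly_Mapping.lookup (G A) m"]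
    by (simp add: lookup_superpol_diag scalar_def lookup_const_mult pointwise)
  moreover have "(of_nat (symbol_degree a A m) :: complex) \<noteq> of_int k"
    using assms(2) by (metis of_int_eq_iff of_int_of_nat_eq of_nat_less_0_iff)
  ultimately show "Poly_Mapping.lookup (F A) m = Poly_Mapping.lookup (0 A) m" by (simp add: pointwise)
qed

lemma weight_zero_lookup:
  assumes "superpol a a F = 0" and "symbol_degree a A m \<noteq> 0"
  shows "Poly_Mapping.lookup (F A) m = 0"
  using lookup_superpol_diag[of a F A m] assms by (simp add: pointwise)

lemma symbol_degree_pos:
  "symbol_degree (Pos p) (insert (p, t) A) m \<noteq> 0"
  "symbol_degree (Neg q) A (m + Poly_Mapping.single (Neg q, t) 1) \<noteq> 0"
  "symbol_degree (Proper i) A (m + Poly_Mapping.single (Proper i, t) 1) \<noteq> 0"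
  by (auto simp: lookup_add intro!: exI[of _ t])

text \<open>Weight zero means that no variable of row a occurs in F.\<close>

lemma superderiv_weight_zero:
  assumes "superpol a a F = 0"
  shows "superderiv a t F = 0"
proof (intro ext poly_mapping_eqI)
  fix A m
  show "Poly_Mapping.lookup (superderiv a t F A) m = Poly_Mapping.lookup (0 A) m"
  proof (cases a)
    case (Pos p)
    have "F (insert (p, t) A) = 0"
    proof (rule poly_mapping_eqI)
      fix k
      show "Poly_Mapping.lookup (F (insert (p, t) A)) k = Poly_Mapping.lookup 0 k"
        using weight_zero_lookup[OF assms, of "insert (p, t) A" k] symbol_degree_pos(1)[of p t A k] Pos
        by (simp del: symbol_degree.simps)
    qed
    then show ?thesis by (simp add: Pos annihilation_def pointwise)
  next
    case (Neg q)
    then show ?thesis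
      using weight_zero_lookup[OF assms, of A "m + Poly_Mapping.single (Neg q, t) 1"]
        symbol_degree_pos(2)[of q A m t]
      by (simp add: lookup_partial_deriv pointwise del: symbol_degree.simps)
  next
    case (Proper i)
    then show ?thesis
      using weight_zero_lookup[OF assms, of A "m + Poly_Mapping.single (Proper i, t) 1"]
        symbol_degree_pos(3)[of i A m t]
      by (simp add: lookup_partial_deriv pointwise del: symbol_degree.simps)
  qed
qed

lemma superpol_weight_zero: "superpol b b F = 0 \<Longrightarrow> superpol a b F = 0"
  by (simp add: superpol_def[of a b] superderiv_weight_zero)

section \<open>Devirtualization on polynomials\<close>

definition rename_proper :: "('l::finite, 'd::finite) mpoly \<Rightarrow> (('p::finite, 'q::finite, 'l) symbol, 'd) mpoly" where
  "rename_proper = subst_mpoly const (\<lambda>(i, t). var (Proper i) t)"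

lemma rename_proper_simps [simp]:
  "rename_proper (f + g) = rename_proper f + rename_proper g"
  "rename_proper (f * g) = rename_proper f * rename_proper g"
  "rename_proper (const c) = const c"
  "rename_proper (var i t) = var (Proper i) t"
  unfolding rename_proper_def
  by (simp_all add: coeff_hom.subst_mpoly_add[OF coeff_hom_const]
      coeff_hom.subst_mpoly_mult[OF coeff_hom_const] coeff_hom.subst_mpoly_const[OF coeff_hom_const]
      coeff_hom.subst_mpoly_var[OF coeff_hom_const])

lemma rename_proper_zero [simp]: "rename_proper 0 = 0"
  using rename_proper_simps(3)[of 0] by simp

lemma rename_proper_sum: "rename_proper (\<Sum>i\<in>I. f i) = (\<Sum>i\<in>I. rename_proper (f i))"
  by (induction I rule: infinite_finite_induct) simp_all

lemma eval_rename_proper: "eval_mpoly y (rename_proper f) = eval_mpoly (\<lambda>(i, t). y (Proper i, t)) f"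
  by (induction f rule: mpoly_induct) simp_all

lemma partial_deriv_rename_proper:
  "partial_deriv (Proper i) t (rename_proper f) = rename_proper (partial_deriv i t f)"
  "partial_deriv (Neg q) t (rename_proper f) = 0"
  by (induction f rule: mpoly_induct) (simp_all add: partial_deriv_add partial_deriv_var_mult)

definition inclusion :: "('l::finite, 'd::finite) mpoly \<Rightarrow> ('p::finite, 'q::finite, 'l, 'd) superpoly" where
  "inclusion f = (\<lambda>A. if A = {} then rename_proper f else 0)"

lemma inclusion_zero [simp]: "inclusion 0 = 0"
  by (simp add: inclusion_def fun_eq_iff pointwise)

lemma inclusion_add: "inclusion (f + g) = inclusion f + inclusion g"
  by (simp add: inclusion_def fun_eq_iff pointwise)

lemma inclusion_const_mult: "inclusion (const c * f) = scalar c * inclusion f"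
  by (simp add: inclusion_def scalar_def fun_eq_iff pointwise)

lemma inclusion_eq_zero_imp:
  assumes "inclusion f = (0 :: ('p::finite, 'q::finite, 'l::finite, 'd::finite) superpoly)"
  shows "f = 0"
proof (rule eval_mpoly_eq_zero_imp_zero)
  fix y :: "'l \<times> 'd \<Rightarrow> complex"
  have "rename_proper f = (0 :: (('p, 'q, 'l) symbol, 'd) mpoly)"
    using fun_cong[OF assms, of "{}"] by (simp add: inclusion_def pointwise)
  then have "eval_mpoly (\<lambda>(a, t). case a of Proper i \<Rightarrow> y (i, t) | _ \<Rightarrow> 0)
      (rename_proper f :: (('p, 'q, 'l) symbol, 'd) mpoly) = 0"
    by simp
  then show "eval_mpoly y f = 0" by (simp add: eval_rename_proper)
qed

lemma superpol_inclusion: "superpol (Proper i) (Proper j) (inclusion f) = inclusion (polarization i j f)"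
  by (rule ext)
    (simp add: superpol_def inclusion_def polarization_def fun_sum_apply rename_proper_sum
      partial_deriv_rename_proper)

lemma superpol_virtual_inclusion:
  assumes "virtual b"
  shows "superpol a b (inclusion f) = 0"
proof (cases b)
  case (Pos p)
  then have "superderiv b t (inclusion f) = 0" for t
    by (simp add: inclusion_def annihilation_def fun_eq_iff pointwise)
  then show ?thesis by (simp add: superpol_def)
next
  case (Neg q)
  then have "superderiv b t (inclusion f) = 0" for t
    by (simp add: inclusion_def partial_deriv_rename_proper fun_eq_iff pointwise)
  then show ?thesis by (simp add: superpol_def)
qed (use assms in simp)

lemma superpols_embed_word:
  "superpols (letters (embed_word w)) (inclusion f) = inclusion (word_action w f)"
proof -
  have "superpols (map (map_prod proper proper) ps) (inclusion f)
      = inclusion (foldr (\<lambda>(a, b). polarization (unletter a) (unletter b)) ps f)" for ps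
    by (induction ps) (auto simp: proper_def superpol_inclusion)
  then show ?thesis by (simp add: embed_word_def word_action_def)
qed

lemma tensor_superaction_embed:
  "tensor_superaction (embed_tensor x) (inclusion f) = inclusion (tensor_action x f)"
  by (induction x rule: poly_mapping_add_induct)
    (simp_all add: embed_tensor_single tensor_superaction_single tensor_action_single
      superpols_embed_word inclusion_const_mult embed_tensor_add tensor_superaction_add_left
      tensor_action_add_left inclusion_add)

lemma superaction_embed: "superaction (embed u) (inclusion f) = inclusion (action u f)"
  by transfer (rule tensor_superaction_embed)

text \<open>The weight in \<gamma> counts how often \<gamma> was created minus how often it was
  annihilated. Before the offending factor acts, this is either negative, which is possible only for
  0, or it is 0 and the factor differentiates in a row that does not occur.\<close>

lemma superpols_irregular:
  assumes "irregular ps"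
  shows "superpols ps (inclusion f) = 0"
proof -
  obtain i \<gamma> where i: "i \<in> {1..length ps}" and \<gamma>: "virtual \<gamma>"
    and count: "count_list (map fst (take (i - 1) (rev ps))) \<gamma> < count_list (map snd (take i (rev ps))) \<gamma>"
    using assms by (auto simp: irregular_def)
  \<comment> \<open>The 0-based position of the offending factor, counted from the right;
    \<open>us\<close> consists of the factors that act before it.\<close>
  define k where "k = i - 1"
  define us where "us = rev (take k (rev ps))"
  obtain a b where ab: "rev ps ! k = (a, b)" by fastforce
  have "i = Suc k" "k < length (rev ps)" using i by (auto simp: k_def)
  then have take_i: "take i (rev ps) = take k (rev ps) @ [rev ps ! k]"
    by (simp add: take_Suc_conv_app_nth)
  define rest where "rest = rev (drop i (rev ps))"
  have "rev ps = take k (rev ps) @ [(a, b)] @ drop i (rev ps)"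
    using append_take_drop_id[of i "rev ps", symmetric] unfolding take_i ab append_assoc .
  from arg_cong[OF this, of rev] have ps: "ps = rest @ (a, b) # us"
    by (simp add: us_def rest_def)
  have "superpols ps (inclusion f) = superpols rest (superpol a b (superpols us (inclusion f)))"
    by (simp only: ps superpols_simps)
  also have "superpol a b (superpols us (inclusion f)) = 0"
  proof -
    let ?F = "superpols us (inclusion f)"
    let ?n = "\<lambda>h. count_list (map h us) \<gamma>"
    have rev_count: "count_list (map h (rev xs)) \<gamma> = count_list (map h xs) \<gamma>"
      for h :: "_ \<Rightarrow> ('a, 'b, 'c) symbol" and xs
      by (simp flip: rev_map)
    have n: "?n fst < ?n snd + of_bool (b = \<gamma>)"
      using count[folded k_def] unfolding take_i by (auto simp: us_def rev_count ab)
    have "superpol \<gamma> \<gamma> (inclusion f) = scalar 0 * inclusion f"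
      using superpol_virtual_inclusion[OF \<gamma>] by simp
    from superpol_diag_superpols[OF this, of us]
    have w: "superpol \<gamma> \<gamma> ?F = scalar (of_int (int (?n fst) - int (?n snd))) * ?F"
      by simp
    show ?thesis
    proof (cases "?n fst < ?n snd")
      case True
      then have "?F = 0" by (intro weight_nonneg[OF w]) simp
      then show ?thesis by simp
    next
      case False
      with n have "b = \<gamma>" by (cases "b = \<gamma>") simp_all
      moreover from this n False have "?n fst = ?n snd" by simp
      ultimately show ?thesis using w by (simp add: superpol_weight_zero)
    qed
  qed
  finally show ?thesis by simp
qed

lemma superaction_Irr: "x \<in> Irr \<Longrightarrow> superaction x (inclusion f) = 0"
  by (induction rule: Irr.induct)
    (simp_all add: superaction_add superaction_mult superaction_e_word superpols_irregular)

text \<open>Whichever candidate the choice operator returns, its difference from x lies in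
  \<open>Irr\<close>, which kills included polynomials.\<close>

lemma superaction_devirt:
  assumes "x \<in> Virt"
  shows "superaction x (inclusion f) = inclusion (action (devirt x) f)"
proof -
  obtain u y where "x = embed u + y" "y \<in> Irr"
    using assms by (auto simp: Virt_def)
  then have "x - embed u \<in> Irr" by simp
  then have "x - embed (devirt x) \<in> Irr"
    unfolding devirt_def by (rule someI)
  from superaction_Irr[OF this, of f] show ?thesis
    by (simp add: superaction_diff superaction_embed)
qed

subsection \<open>Elements of virtual weight zero\<close>

lemma Irr_mult_left: "x \<in> Irr \<Longrightarrow> u * x \<in> Irr"
proof (induction rule: Irr.induct)
  case (base ps v)
  then have "(u * v) * e_word ps \<in> Irr" by (rule Irr.base)
  then show ?case by (simp add: mult.assoc)
qed (auto simp: distrib_left intro: Irr.intros)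

lemma embed_add: "embed (u + v) = embed u + embed v"
  by transfer (simp add: embed_tensor_add relator_ideal.zero)

lemma embed_mult: "embed (u * v) = embed u * embed v"
  by transfer (simp add: embed_tensor_mult relator_ideal.zero)

lemma embed_uminus: "embed (- u) = - embed u"
  by transfer (simp add: embed_tensor_uminus relator_ideal.zero)

lemma embed_one: "embed 1 = 1"
  by transfer
    (simp add: embed_tensor_single embed_word_def zero_word_def relator_ideal.zero flip: single_one)

lemma embed_E: "embed (E a b) = E (proper a) (proper b)"
  by transfer (simp add: embed_tensor_gen relator_ideal.zero)

lemma Virt_Irr: "x \<in> Irr \<Longrightarrow> x \<in> Virt"
  using embed_add[of 0 0] by (force simp: Virt_def)

lemma Virt_embed: "embed u \<in> Virt"
  using Irr.zero by (force simp: Virt_def)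

lemma Virt_zero: "0 \<in> Virt"
  using Virt_Irr[OF Irr.zero] .

lemma Virt_add: "x \<in> Virt \<Longrightarrow> y \<in> Virt \<Longrightarrow> x + y \<in> Virt"
proof -
  assume "x \<in> Virt" "y \<in> Virt"
  then obtain u v a b where "x = embed u + a" "y = embed v + b" "a \<in> Irr" "b \<in> Irr"
    by (auto simp: Virt_def)
  then have "x + y = embed (u + v) + (a + b)" "a + b \<in> Irr"
    by (auto simp: embed_add intro: Irr.add)
  then show ?thesis unfolding Virt_def by blast
qed

lemma Virt_uminus: "x \<in> Virt \<Longrightarrow> - x \<in> Virt"
proof -
  assume "x \<in> Virt"
  then obtain u a where "x = embed u + a" "a \<in> Irr" by (auto simp: Virt_def)
  then have "- x = embed (- u) + (- 1) * a" "(- 1) * a \<in> Irr"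
    by (simp_all only: Irr_mult_left) (simp add: embed_uminus)
  then show ?thesis unfolding Virt_def by blast
qed

lemma Virt_neg_one_power_mult: "x \<in> Virt \<Longrightarrow> (- 1) ^ n * x \<in> Virt"
  by (cases "even n") (simp_all add: Virt_uminus)

lemma E_commutator:
  "E a b * E c d = (if b = c then E a d else 0)
     - (-1) ^ ((parity a + parity b) * (parity c + parity d)) * (if a = d then E c b else 0)
     + (-1) ^ ((parity a + parity b) * (parity c + parity d)) * (E c d * E a b)"
proof -
  let ?s = "(-1) ^ ((parity a + parity b) * (parity c + parity d))"
  have "relator a b c d = gen a b * gen c d - (superbracket a b c d + ?s * (gen c d * gen a b))"
    unfolding relator_def by (simp only: diff_diff_eq add.commute)
  then have "gen a b * gen c d - (superbracket a b c d + ?s * (gen c d * gen a b)) \<in> relator_ideal"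
    using relator_ideal.base[of 1 a b c d 1] by (simp only: mult_1_left mult_1_right)
  then have *: "E a b * E c d = abs_uea (superbracket a b c d + ?s * (gen c d * gen a b))"
    unfolding E.abs_eq times_uea.abs_eq uea.abs_eq_iff .
  have abs_uea: "abs_uea (if P then x else 0) = (if P then abs_uea x else 0)" for P and x :: "'a tensor"
    by (simp add: zero_uea_def)
  have sign: "abs_uea (?s :: 'a tensor) = ?s"
  proof (cases "even ((parity a + parity b) * (parity c + parity d))")
    case True
    show ?thesis unfolding neg_one_even_power[OF True] by (simp add: one_uea_def)
  next
    case False
    show ?thesis unfolding neg_one_odd_power[OF False]
      by (simp add: one_uea_def flip: uminus_uea.abs_eq)
  qed
  show ?thesis
    unfolding * superbracket_def
    by (simp only: abs_uea sign E.abs_eq flip: plus_uea.abs_eq minus_uea.abs_eq times_uea.abs_eq)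
qed

lemma E_virtual_Irr: "virtual b \<Longrightarrow> u * E a b \<in> Irr"
proof -
  assume "virtual b"
  then have "irregular [(a, b)]" by (auto simp: irregular_def)
  from Irr.base[OF this, of u] show ?thesis by (simp add: e_word_def)
qed

definition virtual_balanced :: "(('p, 'q, 'l) symbol \<times> ('p, 'q, 'l) symbol) list \<Rightarrow> bool" where
  "virtual_balanced ps \<longleftrightarrow>
     (\<forall>\<gamma>. virtual \<gamma> \<longrightarrow> count_list (map fst ps) \<gamma> = count_list (map snd ps) \<gamma>)"

lemma e_word_simps [simp]:
  "e_word [] = 1" "e_word ((a, b) # ps) = E a b * e_word ps"
  "e_word (ps @ qs) = e_word ps * e_word qs"
  by (simp_all add: e_word_def)

lemma count_list_Cons: "count_list (x # xs) y = of_bool (x = y) + count_list xs y"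
  by simp

text \<open>A generator \<open>e\<^bsub>a,b\<^esub>\<close> with \<open>b\<close> virtual can be moved to the right end, where it produces an
  element of \<open>Irr\<close>, at the cost of shorter words of the same weight.\<close>

lemma e_word_Virt: "virtual_balanced ps \<Longrightarrow> e_word ps \<in> Virt"
proof (induction "length ps" arbitrary: ps rule: less_induct)
  case less
  show ?case
  proof (cases "\<exists>(a, b)\<in>set ps. virtual b")
    case False
    have "virtual_balanced ps" by fact
    \<comment> \<open>By balance, a virtual first index would occur as a second index as
      well.\<close>
    have "\<not> virtual a" if "(a, b) \<in> set ps" for a b
    proof
      assume "virtual a"
      then have "count_list (map snd ps) a > 0"
        using that \<open>virtual_balanced ps\<close> by (force simp: virtual_balanced_def count_list_0_iff intro!: Nat.gr0I)
      then have "a \<in> snd ` set ps" by (metis count_list_0_iff less_irrefl list.set_map)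
      with False \<open>virtual a\<close> show False by force
    qed
    with False have "\<forall>(a, b)\<in>set ps. \<not> virtual a \<and> \<not> virtual b" by blast
    then have "\<exists>u. e_word ps = embed u"
    proof (induction ps)
      case Nil
      show ?case using embed_one by (metis e_word_simps(1))
    next
      case (Cons p ps)
      then obtain u where "e_word ps = embed u" by auto
      moreover obtain i j where "p = (Proper i, Proper j)"
        using Cons.prems by (cases p; cases "fst p"; cases "snd p") auto
      ultimately have "e_word (p # ps) = embed (E (Letter i) (Letter j) * u)"
        by (simp add: embed_mult embed_E proper_def)
      then show ?case by blast
    qed
    then show ?thesis using Virt_embed by metis
  next
    case True
    then obtain a b us vs where ps: "ps = us @ (a, b) # vs" and b: "virtual b"
      by (auto dest!: split_list)
    \<comment> \<open>Induction on the factors still to be passed; contracted words are shorter by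
      one and fall under the outer induction.\<close>
    have "e_word (us @ (a, b) # vs) \<in> Virt"
      if "length (us @ (a, b) # vs) = length ps" "virtual_balanced (us @ (a, b) # vs)" for us
      using that
    proof (induction vs arbitrary: us)
      case Nil
      then show ?case using E_virtual_Irr[OF b] by (simp add: Virt_Irr)
    next
      case (Cons p vs)
      obtain c d where p: "p = (c, d)" by fastforce
      have balanced: "of_bool (a = \<gamma>) + (of_bool (c = \<gamma>)
            + (count_list (map fst us) \<gamma> + count_list (map fst vs) \<gamma>))
          = of_bool (b = \<gamma>) + (of_bool (d = \<gamma>)
            + (count_list (map snd us) \<gamma> + count_list (map snd vs) \<gamma>))"
        if "virtual \<gamma>" for \<gamma>
        using Cons.prems(2)[unfolded virtual_balanced_def, rule_format, OF that]
        by (simp only: p list.map map_append fst_conv snd_conv count_list_append count_list_Cons)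
      have swap: "virtual_balanced ((us @ [(c, d)]) @ (a, b) # vs)"
        unfolding virtual_balanced_def
        by (intro allI impI, drule balanced,
          simp only: list.map map_append fst_conv snd_conv count_list_append count_list_Cons
            count_list.simps(1))
      have contract: "virtual_balanced (us @ [(a, d)] @ vs)" if "b = c"
        unfolding virtual_balanced_def
        by (intro allI impI, drule balanced,
          simp only: that list.map map_append fst_conv snd_conv count_list_append count_list_Cons
            count_list.simps(1))
      have contract': "virtual_balanced (us @ [(c, b)] @ vs)" if "a = d"
        unfolding virtual_balanced_def
        by (intro allI impI, drule balanced,
          simp only: that list.map map_append fst_conv snd_conv count_list_append count_list_Cons
            count_list.simps(1))
      let ?s = "(- 1) ^ ((parity a + parity b) * (parity c + parity d)) :: ('a, 'b, 'c) symbol uea"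
      let ?w = "\<lambda>qs. e_word (us @ qs @ vs)"
      have comm: "x * (- 1) ^ n = (- 1) ^ n * x" for x :: "('a, 'b, 'c) symbol uea" and n
        by (cases "even n") simp_all
      have "e_word (us @ (a, b) # p # vs) = e_word us * (E a b * E c d) * e_word vs"
        by (simp add: p mult.assoc)
      also have "\<dots> = (if b = c then ?w [(a, d)] else 0)
          - ?s * (if a = d then ?w [(c, b)] else 0) + ?s * e_word ((us @ [(c, d)]) @ (a, b) # vs)"
        by (simp add: E_commutator[of a b c d] distrib_left distrib_right left_diff_distrib
            right_diff_distrib mult.assoc[symmetric] comm) 
      also have "\<dots> = (if b = c then ?w [(a, d)] else 0)
          + - (?s * (if a = d then ?w [(c, b)] else 0)) + ?s * e_word ((us @ [(c, d)]) @ (a, b) # vs)"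
        by simp
      also have "\<dots> \<in> Virt"
      proof (intro Virt_add Virt_uminus Virt_neg_one_power_mult)
        show "e_word ((us @ [(c, d)]) @ (a, b) # vs) \<in> Virt"
          by (rule Cons.IH) (use Cons.prems(1) swap in simp_all)
        have "?w [(a, d)] \<in> Virt" if "b = c"
          by (rule less.hyps) (use Cons.prems(1) contract that in simp_all)
        then show "(if b = c then ?w [(a, d)] else 0) \<in> Virt" by (simp add: Virt_zero)
        have "?w [(c, b)] \<in> Virt" if "a = d"
          by (rule less.hyps) (use Cons.prems(1) contract' that in simp_all)
        then show "(if a = d then ?w [(c, b)] else 0) \<in> Virt" by (simp add: Virt_zero)
      qed
      finally show ?case .
    qed
    then show ?thesis using less.prems by (simp add: ps)
  qed
qed

section \<open>Infinitesimal row and column operations\<close>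

text \<open>The vector field that moves each entry x of the block B with velocity the entry at
  \<sigma> x. It generates a shear if \<sigma> maps B off itself, and a scaling if \<sigma> is the
  identity.\<close>

definition shift_deriv :: "('l \<times> 'd) set \<Rightarrow> ('l \<times> 'd \<Rightarrow> 'l \<times> 'd) \<Rightarrow> ('l, 'd) mpoly \<Rightarrow> ('l, 'd) mpoly" where
  "shift_deriv B \<sigma> f = (\<Sum>x\<in>B. var (fst (\<sigma> x)) (snd (\<sigma> x)) * partial_deriv (fst x) (snd x) f)"

lemma eval_shift_deriv:
  "eval_mpoly y (shift_deriv B \<sigma> f) =
     (\<Sum>x\<in>UNIV. (if x \<in> B then y (\<sigma> x) else 0) * eval_mpoly y (partial_deriv (fst x) (snd x) f))"
  for f :: "('l::finite, 'd::finite) mpoly"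
proof -
  have "(\<Sum>x\<in>UNIV. (if x \<in> B then y (\<sigma> x) else 0) * eval_mpoly y (partial_deriv (fst x) (snd x) f))
      = (\<Sum>x\<in>UNIV. if x \<in> B then y (\<sigma> x) * eval_mpoly y (partial_deriv (fst x) (snd x) f) else 0)"
    by (intro sum.cong) auto
  also have "\<dots> = (\<Sum>x\<in>B. y (\<sigma> x) * eval_mpoly y (partial_deriv (fst x) (snd x) f))"
    by (simp add: sum.If_cases)
  finally show ?thesis
    by (simp add: shift_deriv_def eval_mpoly.hom_sum)
qed

text \<open>The entries at \<sigma> x lie outside B and are not moved, so the velocity does not
  depend on c.\<close>

lemma eval_shear_has_derivative:
  fixes f :: "('l::finite, 'd::finite) mpoly"
  assumes "\<sigma> ` B \<inter> B = {}"
  shows "((\<lambda>c. eval_mpoly (\<lambda>x. if x \<in> B then y x + c * y (\<sigma> x) else y x) f) has_field_derivative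
    eval_mpoly (\<lambda>x. if x \<in> B then y x + c * y (\<sigma> x) else y x) (shift_deriv B \<sigma> f)) (at c)"
proof -
  let ?y = "\<lambda>(c::complex) x. if x \<in> B then y x + c * y (\<sigma> x) else y x"
  have "?y c (\<sigma> x) = y (\<sigma> x)" if "x \<in> B" for x
    using assms that by auto
  then have "(if x \<in> B then ?y c (\<sigma> x) else 0) = (if x \<in> B then y (\<sigma> x) else 0)" for x
    by simp
  moreover have "((\<lambda>c. ?y c x) has_field_derivative (if x \<in> B then y (\<sigma> x) else 0)) (at c)" for x
    by (cases "x \<in> B") (auto intro!: derivative_eq_intros)
  from has_field_derivative_eval_mpoly[OF this, where f = f]
  have "((\<lambda>c. eval_mpoly (?y c) f) has_field_derivative
    (\<Sum>x\<in>UNIV. (if x \<in> B then y (\<sigma> x) else 0) * eval_mpoly (?y c) (partial_deriv (fst x) (snd x) f))) (at c)" .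
  ultimately show ?thesis unfolding eval_shift_deriv by simp
qed

text \<open>Integration gives one direction, differentiation at c = 0 the other. Invariance of v is
  read off from determinants and made infinitesimal; for the vector produced from v the passage goes
  back.\<close>

lemma shift_deriv_eq_zero_iff:
  fixes f :: "('l::finite, 'd::finite) mpoly"
  assumes "\<sigma> ` B \<inter> B = {}"
  shows "shift_deriv B \<sigma> f = 0 \<longleftrightarrow>
    (\<forall>c y. eval_mpoly (\<lambda>x. if x \<in> B then y x + c * y (\<sigma> x) else y x) f = eval_mpoly y f)"
proof (intro iffI allI)
  fix c :: complex and y :: "'l \<times> 'd \<Rightarrow> complex"
  assume zero: "shift_deriv B \<sigma> f = 0"
  let ?y = "\<lambda>(c::complex) x. if x \<in> B then y x + c * y (\<sigma> x) else y x"
  have "?y c (\<sigma> x) = y (\<sigma> x)" if "x \<in> B" for c x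
    using assms that by auto
  then have *: "(if x \<in> B then ?y c (\<sigma> x) else 0) = (if x \<in> B then y (\<sigma> x) else 0)" for c x
    by simp
  have "eval_mpoly (?y c) f = exp (0 * c) * eval_mpoly (?y 0) f"
  proof (rule eval_mpoly_flow)
    show "((\<lambda>c. ?y c x) has_field_derivative (if x \<in> B then y (\<sigma> x) else 0)) (at c)" for c x
      by (cases "x \<in> B") (auto intro!: derivative_eq_intros)
    show "(\<Sum>x\<in>UNIV. (if x \<in> B then y (\<sigma> x) else 0) * eval_mpoly (?y c) (partial_deriv (fst x) (snd x) f))
        = 0 * eval_mpoly (?y c) f" for c
      using eval_shift_deriv[of "?y c" B \<sigma> f] unfolding zero * by simp
  qed
  then show "eval_mpoly (?y c) f = eval_mpoly y f"
    by (simp cong: if_cong)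
next
  assume *: "\<forall>c y. eval_mpoly (\<lambda>x. if x \<in> B then y x + c * y (\<sigma> x) else y x) f = eval_mpoly y f"
  show "shift_deriv B \<sigma> f = 0"
  proof (rule eval_mpoly_eq_zero_imp_zero)
    fix y
    show "eval_mpoly y (shift_deriv B \<sigma> f) = 0"
      using DERIV_unique[OF eval_shear_has_derivative[OF assms, of y f 0]] *
      by (simp cong: if_cong)
  qed
qed

lemma eval_scaling_has_derivative:
  fixes f :: "('l::finite, 'd::finite) mpoly"
  shows "((\<lambda>s. eval_mpoly (\<lambda>x. if x \<in> B then exp s * y x else y x) f) has_field_derivative
    eval_mpoly (\<lambda>x. if x \<in> B then exp s * y x else y x) (shift_deriv B id f)) (at s)"
proof -
  let ?y = "\<lambda>s x. if x \<in> B then exp s * y x else y x"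
  have "((\<lambda>s. ?y s x) has_field_derivative (if x \<in> B then ?y s x else 0)) (at s)" for x
    by (cases "x \<in> B") (auto intro!: derivative_eq_intros)
  from has_field_derivative_eval_mpoly[where y = ?y and f = f, OF this] show ?thesis
    unfolding eval_shift_deriv id_apply .
qed

lemma shift_deriv_id_eigen_iff:
  fixes f :: "('l::finite, 'd::finite) mpoly"
  shows "shift_deriv B id f = const (of_nat k) * f \<longleftrightarrow>
    (\<forall>c y. c \<noteq> 0 \<longrightarrow> eval_mpoly (\<lambda>x. if x \<in> B then c * y x else y x) f = c ^ k * eval_mpoly y f)"
proof (intro iffI allI impI)
  fix c :: complex and y :: "'l \<times> 'd \<Rightarrow> complex"
  assume eigen: "shift_deriv B id f = const (of_nat k) * f" and "c \<noteq> 0"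
  let ?y = "\<lambda>(s::complex) x. if x \<in> B then exp s * y x else y x"
  \<comment> \<open>Scaling by \<open>exp s\<close> is a flow, and \<open>Ln\<close> reaches every
    nonzero factor.\<close>
  have "eval_mpoly (?y (Ln c)) f = exp (of_nat k * Ln c) * eval_mpoly (?y 0) f"
  proof (rule eval_mpoly_flow)
    show "((\<lambda>s. ?y s x) has_field_derivative (if x \<in> B then ?y s (id x) else 0)) (at s)" for s x
      by (cases "x \<in> B") (auto intro!: derivative_eq_intros)
    show "(\<Sum>x\<in>UNIV. (if x \<in> B then ?y s (id x) else 0) * eval_mpoly (?y s) (partial_deriv (fst x) (snd x) f))
        = of_nat k * eval_mpoly (?y s) f" for s
      using eval_shift_deriv[of "?y s" B id f] unfolding eigen by simp
  qed
  then show "eval_mpoly (\<lambda>x. if x \<in> B then c * y x else y x) f = c ^ k * eval_mpoly y f"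
    using \<open>c \<noteq> 0\<close> by (simp add: exp_of_nat_mult cong: if_cong)
next
  assume *: "\<forall>c y. c \<noteq> 0 \<longrightarrow>
    eval_mpoly (\<lambda>x. if x \<in> B then c * y x else y x) f = c ^ k * eval_mpoly y f"
  have "shift_deriv B id f - const (of_nat k) * f = 0"
  proof (rule eval_mpoly_eq_zero_imp_zero)
    fix y :: "'l \<times> 'd \<Rightarrow> complex"
    have "((\<lambda>s. exp (of_nat k * s) * eval_mpoly y f) has_field_derivative
        exp (of_nat k * 0) * (of_nat k * 1) * eval_mpoly y f) (at 0)"
      by (intro DERIV_cmult_right DERIV_fun_exp DERIV_cmult DERIV_ident)
    then show "eval_mpoly y (shift_deriv B id f - const (of_nat k) * f) = 0"
      using DERIV_unique[OF eval_scaling_has_derivative[of B y f 0]] *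
      by (simp add: eval_mpoly.hom_minus exp_of_nat_mult cong: if_cong)
  qed
  then show "shift_deriv B id f = const (of_nat k) * f" by simp
qed

section \<open>The action of the tableau words\<close>

lemma superpol_even_commute:
  assumes "parity a = parity b" and "a \<noteq> d"
  shows "superpol a b (superpol c d F) =
    superpol c d (superpol a b F) + (if b = c then superpol a d F else 0)"
  using superpol_commutator[of a b c d F] assms by (simp add: power_mult power_add flip: mult_2)

lemma superpols_even_commute:
  assumes "parity a = parity b" and "\<And>c d. (c, d) \<in> set ps \<Longrightarrow> c \<noteq> b \<and> d \<noteq> a"
  shows "superpol a b (superpols ps F) = superpols ps (superpol a b F)"
  using assms(2)
proof (induction ps)
  case (Cons p ps)
  obtain c d where p: "p = (c, d)" by fastforce
  with Cons.prems have "c \<noteq> b" "d \<noteq> a" by auto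
  moreover have "superpol a b (superpols ps F) = superpols ps (superpol a b F)"
    by (rule Cons.IH) (use Cons.prems in auto)
  ultimately show ?case
    using superpol_even_commute[OF assms(1), of d c "superpols ps F"] by (auto simp: p)
qed simp

lemma superpoly_eq_uminus_self: "F = - F \<Longrightarrow> F = (0 :: ('p, 'q, 'l, 'd) superpoly)"
proof (intro ext poly_mapping_eqI)
  fix A m
  assume "F = - F"
  then have "F A = - F A" by (metis uminus_apply)
  then have "Poly_Mapping.lookup (F A) m = - Poly_Mapping.lookup (F A) m" by (metis lookup_uminus)
  then show "Poly_Mapping.lookup (F A) m = Poly_Mapping.lookup (0 A) m" by (simp add: pointwise)
qed

section \<open>Anticommuting generators of a single row\<close>

lemma superpol_Neg_Pos_anticommute:
  "superpol (Neg x) (Pos p) (superpol (Neg y) (Pos p) F)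
    = - superpol (Neg y) (Pos p) (superpol (Neg x) (Pos p) F)"
  using superpol_commutator[of "Neg x" "Pos p" "Neg y" "Pos p" F] by simp

definition row_word :: "'p \<Rightarrow> 'q list \<Rightarrow> (('p, 'q, 'l) symbol \<times> ('p, 'q, 'l) symbol) list" where
  "row_word p = map (\<lambda>c. (Neg c, Pos p))"

lemma row_word_simps [simp]:
  "row_word p [] = []" "row_word p (c # cs) = (Neg c, Pos p) # row_word p cs"
  "row_word p (cs @ cs') = row_word p cs @ row_word p cs'"
  by (simp_all add: row_word_def)

text \<open>Anticommutation brings the generator next to its equal, and its square is zero.\<close>

lemma row_word_repeat_left:
  "c \<in> set cs \<Longrightarrow> superpol (Neg c) (Pos p) (superpols (row_word p cs) F) = 0"
proof (induction cs)
  case (Cons c' cs)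
  let ?G = "superpols (row_word p cs) F"
  have *: "superpol (Neg c) (Pos p) (superpol (Neg c') (Pos p) ?G)
      = - superpol (Neg c') (Pos p) (superpol (Neg c) (Pos p) ?G)"
    by (rule superpol_Neg_Pos_anticommute)
  show ?case
  proof (cases "c = c'")
    case True
    with * have "superpol (Neg c) (Pos p) (superpol (Neg c') (Pos p) ?G) = 0"
      by (intro superpoly_eq_uminus_self) simp
    then show ?thesis by simp
  next
    case False
    with Cons have "superpol (Neg c) (Pos p) ?G = 0" by simp
    with * show ?thesis by simp
  qed
qed simp

lemma row_word_repeat_right:
  "c \<in> set cs \<Longrightarrow> superpols (row_word p cs) (superpol (Neg c) (Pos p) F) = 0"
proof (induction cs)
  case (Cons c' cs)
  show ?case
  proof (cases "c \<in> set cs")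
    case True
    with Cons.IH show ?thesis by simp
  next
    case False
    with Cons.prems have "c = c'" by simp
    then show ?thesis
      using row_word_repeat_left[of c "cs @ [c]" p F] by simp
  qed
qed simp

text \<open>Replacing a letter of a row by one that already occurs in it gives zero.\<close>

lemma row_word_shear_after:
  assumes "x \<in> set pre"
  shows "superpols (row_word p pre) (superpol (Neg x) (Neg y) (superpols (row_word p cs) F))
    = superpols (row_word p (pre @ cs)) (superpol (Neg x) (Neg y) F)"
  using assms
proof (induction cs arbitrary: pre)
  case (Cons c cs)
  let ?G = "superpols (row_word p cs) F"
  have "superpol (Neg x) (Neg y) (superpol (Neg c) (Pos p) ?G)
      = superpol (Neg c) (Pos p) (superpol (Neg x) (Neg y) ?G)
        + (if y = c then superpol (Neg x) (Pos p) ?G else 0)"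
    using superpol_even_commute[of "Neg x" "Neg y" "Pos p" "Neg c" ?G] by simp
  moreover have "superpols (row_word p pre) (superpol (Neg x) (Pos p) ?G) = 0"
    using Cons.prems by (rule row_word_repeat_right)
  ultimately have "superpols (row_word p pre) (superpol (Neg x) (Neg y) (superpol (Neg c) (Pos p) ?G))
      = superpols (row_word p (pre @ [c])) (superpol (Neg x) (Neg y) ?G)"
    by (simp add: superpols_add)
  also have "\<dots> = superpols (row_word p ((pre @ [c]) @ cs)) (superpol (Neg x) (Neg y) F)"
    by (rule Cons.IH) (use Cons.prems in simp)
  finally show ?case by simp
qed simp

text \<open>A contraction occurs only at \<open>\<beta> j\<close> and replaces it by
  \<open>\<beta> i\<close>. Since i < j, that letter already stands further left in the row, and the
  repetition gives zero.\<close>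

lemma row_word_shear:
  fixes F :: "('p::finite, 'q, 'l, 'd::finite) superpoly"
  assumes inj: "inj_on \<beta> {..<n}" and "i < j" "j < n" "k \<le> n"
  shows "superpol (Neg (\<beta> i)) (Neg (\<beta> j)) (superpols (row_word p (map \<beta> [0..<k])) F)
    = superpols (row_word p (map \<beta> [0..<k])) (superpol (Neg (\<beta> i)) (Neg (\<beta> j)) F)"
proof -
  have eq: "\<beta> a = \<beta> b \<longleftrightarrow> a = b" if "a < n" "b < n" for a b
    using inj that by (auto simp: inj_on_def)
  have before: "superpol (Neg (\<beta> i)) (Neg (\<beta> j)) (superpols (row_word p (map \<beta> [0..<m])) G)
    = superpols (row_word p (map \<beta> [0..<m])) (superpol (Neg (\<beta> i)) (Neg (\<beta> j)) G)"
    if "m \<le> j" for m and G :: "('p, 'q, 'l, 'd) superpoly"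
    by (rule superpols_even_commute) (use that assms in \<open>auto simp: row_word_def eq\<close>)
  show ?thesis
  proof (cases "k \<le> j")
    case True
    then show ?thesis by (rule before)
  next
    case False
    have "[0..<k] = [0..<Suc i] @ [Suc i..<k]"
      using upt_add_eq_append[of 0 "Suc i" "k - Suc i"] False \<open>i < j\<close> by (simp del: upt_Suc)
    then have split: "map \<beta> [0..<k] = map \<beta> [0..<Suc i] @ map \<beta> [Suc i..<k]"
      by (metis map_append)
    show ?thesis
      unfolding split row_word_simps superpols_simps
      using before[of "Suc i"] row_word_shear_after[of "\<beta> i" "map \<beta> [0..<Suc i]"] \<open>i < j\<close>
      by (simp del: upt_Suc)
  qed
qed

section \<open>The words of the starred tableaux\<close>

lemma zip_concat:
  "map length xss = map length yss \<Longrightarrow> zip (concat xss) (concat yss) = concat (map2 zip xss yss)"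
proof (induction xss arbitrary: yss)
  case (Cons xs xss)
  then obtain ys yss' where "yss = ys # yss'" by (cases yss) auto
  with Cons show ?case by simp
qed simp

lemma zip_row_word:
  "zip (map (\<lambda>s. Neg (\<beta> s)) [0..<k]) (replicate k (Pos a)) = row_word a (map \<beta> [0..<k])"
  by (simp add: row_word_def zip_replicate2)

lemma zip_D_star_C_star:
  "zip (concat (D_star \<beta> p)) (concat (C_star \<alpha> p))
    = concat (map (\<lambda>r. row_word (\<alpha> r) (map \<beta> [0..<p ! r])) [0..<length p])"
proof -
  have D: "D_star \<beta> p = map (\<lambda>r. map (\<lambda>s. Neg (\<beta> s)) [0..<p ! r]) [0..<length p]"
    unfolding D_star_def by (subst (1) map_nth[symmetric]) (simp only: map_map comp_def)
  show ?thesis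
    by (subst zip_concat)
      (simp_all add: D C_star_def zip_map_map zip_same_conv_map comp_def zip_row_word)
qed

lemma D_star_C_star_shear:
  assumes "inj_on \<beta> {..<n}" and "i < j" "j < n" "\<And>k. k \<in> set p \<Longrightarrow> k \<le> n"
  shows "superpol (Neg (\<beta> i)) (Neg (\<beta> j))
      (superpols (zip (concat (D_star \<beta> p)) (concat (C_star \<alpha> p))) F)
    = superpols (zip (concat (D_star \<beta> p)) (concat (C_star \<alpha> p))) (superpol (Neg (\<beta> i)) (Neg (\<beta> j)) F)"
proof -
  have "superpol (Neg (\<beta> i)) (Neg (\<beta> j))
      (superpols (concat (map (\<lambda>r. row_word (\<alpha> r) (map \<beta> [0..<p ! r])) rs)) F)
    = superpols (concat (map (\<lambda>r. row_word (\<alpha> r) (map \<beta> [0..<p ! r])) rs))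
        (superpol (Neg (\<beta> i)) (Neg (\<beta> j)) F)" if "set rs \<subseteq> {..<length p}" for rs
    using that
  proof (induction rs)
    case (Cons r rs)
    then have "p ! r \<le> n" by (intro assms(4)) simp
    with Cons show ?case by (simp add: row_word_shear[OF assms(1-3)])
  qed simp
  then show ?thesis unfolding zip_D_star_C_star by (simp add: lessThan_atLeast0)
qed

lemma length_concat_star [simp]:
  "length (concat (D_star \<beta> p)) = sum_list p" "length (concat (C_star \<alpha> p)) = sum_list p"
  by (simp_all add: D_star_def C_star_def length_concat comp_def map_nth)

lemma length_concat_tableau: "S \<in> tableaux p \<Longrightarrow> length (concat S) = sum_list p"
  by (auto simp: tableaux_def length_concat)

text \<open>Every row longer than s contains \<open>\<beta> s\<close> exactly once. These numbers
  become the row weights.\<close>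

lemma count_list_concat_D_star:
  assumes "inj_on \<beta> {..<n}" and "s < n" and "\<And>k. k \<in> set p \<Longrightarrow> k \<le> n"
  shows "count_list (concat (D_star \<beta> p)) (Neg (\<beta> s)) = length (filter (\<lambda>k. s < k) p)"
  using assms(3)
proof (induction p)
  case (Cons k p)
  have "count_list (map (\<lambda>s. Neg (\<beta> s)) [0..<m]) (Neg (\<beta> s)) = of_bool (s < m)" if "m \<le> n" for m
    using that
  proof (induction m)
    case (Suc m)
    then have "\<beta> m = \<beta> s \<longleftrightarrow> m = s" using assms(1,2) by (auto simp: inj_on_def)
    with Suc show ?case by auto
  qed simp
  from this[of k] Cons show ?case by (auto simp: D_star_def)
qed (simp add: D_star_def)

lemma count_list_concat_C_star_Neg: "count_list (concat (C_star \<alpha> p)) (Neg x) = 0"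
  by (auto simp: count_list_0_iff C_star_def)

lemma count_list_concat_D_star_Pos: "count_list (concat (D_star \<beta> p)) (Pos x) = 0"
  by (auto simp: count_list_0_iff D_star_def)

lemma count_list_concat_Proper:
  "virtual \<gamma> \<Longrightarrow> count_list (concat (map (map Proper) S)) \<gamma> = 0"
  by (auto simp: count_list_0_iff)

section \<open>Row and column operators on coefficients\<close>

lemma colpol_superpols: "colpol t u (superpols ps F) = superpols ps (colpol t u F)"
  by (induction ps) (auto simp: colpol_superpol)

lemma sum_Times_singleton: "(\<Sum>x\<in>A \<times> {u}. h x) = (\<Sum>a\<in>A. h (a, u))"
  by (rule sum.reindex_bij_witness[of _ "\<lambda>a. (a, u)" fst]) auto

lemma sum_singleton_Times: "(\<Sum>x\<in>{a} \<times> B. h x) = (\<Sum>b\<in>B. h (a, b))"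
  by (rule sum.reindex_bij_witness[of _ "\<lambda>b. (a, b)" snd]) auto

lemma colpol_inclusion:
  "colpol t u (inclusion f :: ('p::finite, 'q::finite, 'l::finite, 'd::finite) superpoly)
    = inclusion (shift_deriv (UNIV \<times> {u}) (\<lambda>x. (fst x, t)) f)"
  (is "_ = inclusion ?g")
proof -
  have "colpol t u (inclusion f :: ('p, 'q, 'l, 'd) superpoly)
    = (\<Sum>a\<in>range Proper. supervar a t (superderiv a u (inclusion f)))"
    unfolding colpol_def
  proof (rule sum.mono_neutral_right)
    show "\<forall>a\<in>UNIV - range Proper.
        supervar a t (superderiv a u (inclusion f :: ('p, 'q, 'l, 'd) superpoly)) = 0"
    proof
      fix a :: "('p, 'q, 'l) symbol"
      assume "a \<in> UNIV - range Proper"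
      then have "virtual a" by (cases a) auto
      then have "superderiv a u (inclusion f :: ('p, 'q, 'l, 'd) superpoly) = 0"
        by (intro superderiv_weight_zero superpol_virtual_inclusion)
      then show "supervar a t (superderiv a u (inclusion f :: ('p, 'q, 'l, 'd) superpoly)) = 0"
        by simp
    qed
  qed auto
  also have "\<dots> = (\<Sum>i\<in>UNIV. supervar (Proper i) t (superderiv (Proper i) u (inclusion f)))"
    by (simp add: sum.reindex inj_def)
  also have "\<dots> = inclusion (\<Sum>i\<in>UNIV. var i t * partial_deriv i u f)"
    by (rule ext) (simp add: fun_sum_apply inclusion_def partial_deriv_rename_proper rename_proper_sum)
  also have "(\<Sum>i\<in>UNIV. var i t * partial_deriv i u f) = ?g"
    by (simp add: shift_deriv_def sum_Times_singleton)
  finally show ?thesis .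
qed

text \<open>A positive row contributes an odd variable in front, hence nothing at the empty
  monomial.\<close>

lemma colpol_at_empty:
  fixes F :: "('p::finite, 'q::finite, 'l::finite, 'd::finite) superpoly"
  shows "colpol t u F {} = shift_deriv ((- range Pos) \<times> {u}) (\<lambda>x. (fst x, t)) (F {})"
proof -
  have "colpol t u F {} = (\<Sum>a\<in>- range Pos. supervar a t (superderiv a u F) {})"
    unfolding colpol_def fun_sum_apply
    by (rule sum.mono_neutral_right) (auto simp: creation_def)
  also have "\<dots> = (\<Sum>a\<in>- range Pos. var a t * partial_deriv a u (F {}))"
  proof (rule sum.cong)
    fix a :: "('p, 'q, 'l) symbol"
    assume "a \<in> - range Pos"
    then show "supervar a t (superderiv a u F) {} = var a t * partial_deriv a u (F {})"
      by (cases a) auto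
  qed simp
  finally show ?thesis
    by (simp add: shift_deriv_def sum_Times_singleton)
qed

lemma superpol_Neg_at_empty:
  "superpol (Neg x) (Neg y) F {} = shift_deriv ({Neg y} \<times> UNIV) (\<lambda>z. (Neg x, snd z)) (F {})"
  by (simp add: superpol_def fun_sum_apply shift_deriv_def sum_singleton_Times)

section \<open>The vanishing theorem\<close>

lemma part_antimono:
  assumes "is_partition p" and "i \<le> j"
  shows "part p j \<le> part p i"
  using assms by (auto simp: is_partition_def part_def sorted_wrt_iff_nth_less le_less)

text \<open>The rows longer than j form an initial segment, so their number decides which rows
  belong to it.\<close>

lemma less_card_part_iff:
  assumes "is_partition p"
  shows "i < card {i. j < part p i} \<longleftrightarrow> j < part p i"
proof -
  let ?S = "{i. j < part p i}"
  have fin: "finite ?S"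
    by (rule finite_subset[of _ "{..<length p}"]) (auto simp: part_def split: if_splits)
  show ?thesis
  proof
    assume "j < part p i"
    then have "{..i} \<subseteq> ?S" using part_antimono[OF assms] order_less_le_trans by blast
    from card_mono[OF fin this] show "i < card ?S" by simp
  next
    assume less: "i < card ?S"
    show "j < part p i"
    proof (rule ccontr)
      assume "\<not> j < part p i"
      then have "k < i" if "j < part p k" for k
        using part_antimono[OF assms, of i k] that by (meson dual_order.strict_trans1 not_le)
      then have "?S \<subseteq> {..<i}" by blast
      from card_mono[OF _ this] less show False by simp
    qed
  qed
qed

lemma conj_partition_eq: "conj_partition p = map (\<lambda>j. card {i. j < part p i}) [0..<part p 0]"
  by (simp add: conj_partition_def ferrers_def)

text \<open>Column j is longer than i exactly if row i is longer than j: conjugation is an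
  involution.\<close>

lemma length_filter_conj_partition:
  assumes "is_partition p"
  shows "length (filter (\<lambda>k. i < k) (conj_partition p)) = part p i"
proof -
  have "filter (\<lambda>j. j < m) [0..<n] = [0..<min m n]" for m n
    by (induction n) (auto simp: min_def le_Suc_eq)
  then have "filter (\<lambda>j. j < part p i) [0..<part p 0] = [0..<part p i]"
    using part_antimono[OF assms, of 0 i] by (simp add: min_absorb1)
  then show ?thesis
    by (simp add: conj_partition_eq filter_map comp_def less_card_part_iff[OF assms])
qed

lemma conj_partition_le:
  assumes "is_partition p" and "k \<in> set (conj_partition p)"
  shows "k \<le> part (conj_partition p) 0"
proof -
  obtain j where j: "j < part p 0" "k = card {i. j < part p i}"
    using assms(2) by (auto simp: conj_partition_eq)
  then have "part (conj_partition p) 0 = card {i. 0 < part p i}"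
    by (simp add: conj_partition_eq part_def)
  moreover have "finite {i. 0 < part p i}"
    by (rule finite_subset[of _ "{..<length p}"]) (auto simp: part_def split: if_splits)
  ultimately show ?thesis using j by (auto intro!: card_mono)
qed

lemma less_part_conj_partition:
  assumes "is_partition p" and "0 < part p i"
  shows "i < part (conj_partition p) 0"
proof -
  have "0 < part p 0" using part_antimono[OF assms(1), of 0 i] assms(2) by simp
  then have "part (conj_partition p) 0 = card {i. 0 < part p i}"
    by (simp add: conj_partition_eq part_def)
  with less_card_part_iff[OF assms(1), of i 0] assms(2) show ?thesis by simp
qed

section \<open>Column operations on the canonical highest weight vector\<close>

lemma bij_betw_nth_element: "bij_betw nth_element {..<CARD('a)} (UNIV :: 'a::{finite, linorder} set)"
proof -
  have "bij_betw ((!) (sorted_list_of_set (UNIV :: 'a set))) {..<CARD('a)} UNIV"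
    by (rule bij_betw_nth) simp_all
  then show ?thesis
    by (simp add: nth_element_def[abs_def])
qed

lemma nth_element_eq_iff:
  "i < CARD('a) \<Longrightarrow> j < CARD('a) \<Longrightarrow> nth_element i = (nth_element j :: 'a::{finite, linorder}) \<longleftrightarrow> i = j"
  using bij_betw_nth_element[where 'a = 'a] by (auto simp: bij_betw_def inj_on_def)

lemma eval_highest_weight_vector:
  "eval_mpoly y (highest_weight_vector q) =
     (\<Prod>k\<leftarrow>q. det (mat k k (\<lambda>(s, t). y (nth_element s, nth_element t))))"
proof -
  have "eval_mpoly y (row_minor (map nth_element [0..<k]))
      = det (mat k k (\<lambda>(s, t). y (nth_element s, nth_element t)))" for k
  proof -
    have "map_mat (eval_mpoly y) (mat k k (\<lambda>(s, t). var (map nth_element [0..<k] ! s) (nth_element t)))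
        = mat k k (\<lambda>(s, t). y (nth_element s, nth_element t))"
      by (rule eq_matI) auto
    then show ?thesis
      unfolding row_minor_def by (simp flip: eval_mpoly.hom_det)
  qed
  then show ?thesis
    by (simp add: highest_weight_vector_def bideterminant_def eval_mpoly.hom_prod_list comp_def)
qed

text \<open>A minor that contains column j is formed from leading columns, so it contains column i
  as well and undergoes a column addition.\<close>

lemma eval_highest_weight_vector_shear:
  fixes y :: "'l::{finite, linorder} \<times> 'd::{finite, linorder} \<Rightarrow> complex"
  assumes "i < j" "j < CARD('d)" "\<And>k. k \<in> set q \<Longrightarrow> k \<le> CARD('d)"
  shows "eval_mpoly (\<lambda>x. if x \<in> UNIV \<times> {nth_element j} then y x + c * y (fst x, nth_element i) else y x)
    (highest_weight_vector q) = eval_mpoly y (highest_weight_vector q)"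
proof -
  let ?y = "\<lambda>x. if x \<in> UNIV \<times> {nth_element j} then y x + c * y (fst x, nth_element i) else y x"
  have "det (mat k k (\<lambda>(s, t). ?y (nth_element s, nth_element t)))
      = det (mat k k (\<lambda>(s, t). y (nth_element s, nth_element t)))" if "k \<in> set q" for k
  proof (cases "j < k")
    case True
    let ?A = "mat k k (\<lambda>(s, t). y (nth_element s, nth_element t))"
    have "mat k k (\<lambda>(s, t). ?y (nth_element s, nth_element t)) = addcol c j i ?A"
      using assms(1,2) assms(3)[OF that] True
      by (intro eq_matI) (auto simp: nth_element_eq_iff)
    then show ?thesis using assms(1) True by (simp add: det_addcol[of i k j ?A])
  next
    case False
    then have "mat k k (\<lambda>(s, t). ?y (nth_element s, nth_element t))
        = mat k k (\<lambda>(s, t). y (nth_element s, nth_element t))"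
      using assms(2) assms(3)[OF that] by (intro eq_matI) (auto simp: nth_element_eq_iff)
    then show ?thesis by simp
  qed
  then show ?thesis
    unfolding eval_highest_weight_vector by (intro arg_cong[of _ _ prod_list] map_cong refl)
qed

text \<open>Column i enters exactly the minors of size greater than i, each of which contributes one
  factor c.\<close>

lemma eval_highest_weight_vector_scale:
  fixes y :: "'l::{finite, linorder} \<times> 'd::{finite, linorder} \<Rightarrow> complex"
  assumes "i < CARD('d)" "\<And>k. k \<in> set q \<Longrightarrow> k \<le> CARD('d)"
  shows "eval_mpoly (\<lambda>x. if x \<in> UNIV \<times> {nth_element i} then c * y x else y x) (highest_weight_vector q)
    = c ^ length (filter (\<lambda>k. i < k) q) * eval_mpoly y (highest_weight_vector q)"
proof -
  let ?y = "\<lambda>x. if x \<in> UNIV \<times> {nth_element i} then c * y x else y x"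
  have "det (mat k k (\<lambda>(s, t). ?y (nth_element s, nth_element t)))
      = (if i < k then c else 1) * det (mat k k (\<lambda>(s, t). y (nth_element s, nth_element t)))"
    if "k \<in> set q" for k
  proof (cases "i < k")
    case True
    let ?A = "mat k k (\<lambda>(s, t). y (nth_element s, nth_element t))"
    have "mat k k (\<lambda>(s, t). ?y (nth_element s, nth_element t)) = multcol i c ?A"
      using assms(1) assms(2)[OF that] True
      by (intro eq_matI) (auto simp: nth_element_eq_iff)
    also have "\<dots> = ?A * multrow_mat k i c"
      by (rule multcol_mat[of _ k]) simp
    also have "det \<dots> = c * det ?A"
      using True by (subst det_mult[of _ k]) (simp_all add: det_multrow_mat)
    finally show ?thesis using True by simp
  next
    case False
    then have "mat k k (\<lambda>(s, t). ?y (nth_element s, nth_element t))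
        = mat k k (\<lambda>(s, t). y (nth_element s, nth_element t))"
      using assms(1) assms(2)[OF that] by (intro eq_matI) (auto simp: nth_element_eq_iff)
    with False show ?thesis by simp
  qed
  then have "(\<Prod>k\<leftarrow>q. det (mat k k (\<lambda>(s, t). ?y (nth_element s, nth_element t))))
    = (\<Prod>k\<leftarrow>q. (if i < k then c else 1) * det (mat k k (\<lambda>(s, t). y (nth_element s, nth_element t))))"
    by (intro arg_cong[of _ _ prod_list] map_cong refl)
  also have "\<dots> = c ^ length (filter (\<lambda>k. i < k) q)
      * (\<Prod>k\<leftarrow>q. det (mat k k (\<lambda>(s, t). y (nth_element s, nth_element t))))"
    by (induction q) auto
  finally show ?thesis unfolding eval_highest_weight_vector .
qed

text \<open>The vector \<open>e\<^bsub>D,C\<^esub> e\<^bsub>C,T\<^esub> v\<close> has weight \<open>lam\<close> for the row operations among the \<open>\<beta>\<close>'s and weight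
  \<open>mu\<close> for the column operations.\<close>

lemma superpols_D_C_T_eq_zero:
  fixes v :: "('l::{finite, linorder}, 'd::{finite, linorder}) mpoly"
    and \<alpha> :: "nat \<Rightarrow> 'p::finite" and \<beta> :: "nat \<Rightarrow> 'q::finite"
  assumes inj: "inj_on \<beta> {..<n}" and p: "\<And>k. k \<in> set p \<Longrightarrow> k \<le> n"
    and T: "T \<in> tableaux p"
    and shear: "\<And>i j. i < j \<Longrightarrow> j < CARD('d) \<Longrightarrow>
      shift_deriv (UNIV \<times> {nth_element j}) (\<lambda>x. (fst x, nth_element i)) v = 0"
    and weight: "\<And>i. i < CARD('d) \<Longrightarrow> shift_deriv (UNIV \<times> {nth_element i}) id v = const (of_nat (mu i)) * v"
    and i0: "i0 < n" "i0 < CARD('d) \<Longrightarrow> mu i0 < length (filter (\<lambda>k. i0 < k) p)"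
      "0 < length (filter (\<lambda>k. i0 < k) p)"
  shows "superpols (zip (concat (D_star \<beta> p)) (concat (C_star \<alpha> p)))
      (superpols (zip (concat (C_star \<alpha> p)) (concat (map (map Proper) T)))
        (inclusion v :: ('p, 'q, 'l, 'd) superpoly)) = 0"
proof -
  let ?lam = "\<lambda>i. length (filter (\<lambda>k. i < k) p)"
  let ?DC = "zip (concat (D_star \<beta> p)) (concat (C_star \<alpha> p))
    :: (('p, 'q, 'l) symbol \<times> ('p, 'q, 'l) symbol) list"
  let ?CT = "zip (concat (C_star \<alpha> p)) (concat (map (map Proper) T))
    :: (('p, 'q, 'l) symbol \<times> ('p, 'q, 'l) symbol) list"
  define u :: "('p, 'q, 'l, 'd) superpoly" where "u = superpols (?DC @ ?CT) (inclusion v)"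
  have len: "length (concat (map (map Proper) T :: ('p, 'q, 'l) symbol list list)) = sum_list p"
    using length_concat_tableau[OF T] by (simp add: length_concat comp_def)
  have fst: "map fst (?DC @ ?CT) = concat (D_star \<beta> p) @ concat (C_star \<alpha> p)"
    and snd: "map snd (?DC @ ?CT) = concat (C_star \<alpha> p) @ concat (map (map Proper) T)"
    using len by (simp_all add: map_fst_zip map_snd_zip)
  have diag: "superpol a a u
      = scalar (of_nat (count_list (map fst (?DC @ ?CT)) a) - of_nat (count_list (map snd (?DC @ ?CT)) a)) * u"
    if "virtual a" for a
  proof -
    have "superpol a a (inclusion v :: ('p, 'q, 'l, 'd) superpoly) = scalar 0 * inclusion v"
      by (simp add: superpol_virtual_inclusion[OF that])
    from superpol_diag_superpols[OF this, of "?DC @ ?CT"] show ?thesis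
      unfolding u_def add_0_left .
  qed
  \<comment> \<open>\<open>?CT\<close> creates each positive symbol as often as \<open>?DC\<close>
    annihilates it, so no odd variable is left.\<close>
  have u_off: "u A = 0" if nonempty: "A \<noteq> {}" for A
  proof (rule poly_mapping_eqI)
    fix m :: "('p, 'q, 'l) symbol \<times> 'd \<Rightarrow>\<^sub>0 nat"
    obtain a t where at: "(a, t) \<in> A" using nonempty by auto
    have "superpol (Pos a) (Pos a) u = 0"
      using diag[of "Pos a"] unfolding fst snd
      by (simp add: count_list_concat_D_star_Pos count_list_concat_Proper)
    moreover have "symbol_degree (Pos a) A m \<noteq> 0"
      using at by (auto simp: card_eq_0_iff)
    ultimately show "Poly_Mapping.lookup (u A) m = Poly_Mapping.lookup 0 m"
      by (simp add: weight_zero_lookup)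
  qed
  \<comment> \<open>The operator passes \<open>?DC\<close> by the repetition argument and
    \<open>?CT\<close> because no \<beta> occurs there; then it meets a polynomial without \<beta>
    rows.\<close>
  have row_shear: "superpol (Neg (\<beta> i)) (Neg (\<beta> j)) u = 0" if "i < j" "j < n" for i j
  proof -
    have "superpol (Neg (\<beta> i)) (Neg (\<beta> j)) u
        = superpols ?DC (superpol (Neg (\<beta> i)) (Neg (\<beta> j)) (superpols ?CT (inclusion v)))"
      unfolding u_def superpols_simps by (rule D_star_C_star_shear[OF inj that p])
    also have "superpol (Neg (\<beta> i)) (Neg (\<beta> j)) (superpols ?CT (inclusion v :: ('p, 'q, 'l, 'd) superpoly))
        = superpols ?CT (superpol (Neg (\<beta> i)) (Neg (\<beta> j)) (inclusion v))"
    proof (rule superpols_even_commute)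
      fix c d assume "(c, d) \<in> set ?CT"
      then have "c \<in> set (concat (C_star \<alpha> p))" "d \<in> set (concat (map (map Proper) T))"
        by (auto dest: set_zip_leftD set_zip_rightD)
      then show "c \<noteq> Neg (\<beta> j) \<and> d \<noteq> Neg (\<beta> i)" by (auto simp: C_star_def)
    qed simp
    also have "superpol (Neg (\<beta> i)) (Neg (\<beta> j)) (inclusion v :: ('p, 'q, 'l, 'd) superpoly) = 0"
      by (rule superpol_virtual_inclusion) simp
    finally show ?thesis by simp
  qed
  have row_weight: "superpol (Neg (\<beta> i)) (Neg (\<beta> i)) u = scalar (of_nat (?lam i)) * u" if "i < n" for i
    using diag[of "Neg (\<beta> i)"] unfolding fst snd
    by (simp add: count_list_concat_D_star[OF inj that p] count_list_concat_C_star_Neg count_list_concat_Proper)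
  have col_shear: "colpol (nth_element i) (nth_element j) u = 0" if "i < j" "j < CARD('d)" for i j
    unfolding u_def colpol_superpols colpol_inclusion shear[OF that] by simp
  have col_weight: "colpol (nth_element i) (nth_element i) u = scalar (of_nat (mu i)) * u"
    if "i < CARD('d)" for i
  proof -
    have "shift_deriv (UNIV \<times> {nth_element i}) (\<lambda>x. (fst x, nth_element i)) v = const (of_nat (mu i)) * v"
      using weight[OF that] by (simp add: shift_deriv_def sum_Times_singleton)
    then show ?thesis
      unfolding u_def colpol_superpols colpol_inclusion
      by (simp only: inclusion_const_mult superpols_scalar)
  qed
  have "u {} = 0"
  proof (rule biweight_vector_eq_zero[where b = "\<lambda>i. Neg (\<beta> i)" and k = n and Rw = "- range Pos"
        and e = nth_element and d = "CARD('d)" and lam = ?lam and mu = mu and ?j0.0 = i0])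
    show "inj_on (\<lambda>i. Neg (\<beta> i) :: ('p, 'q, 'l) symbol) {..<n}"
      using inj by (auto simp: inj_on_def)
    show "bij_betw nth_element {..<CARD('d)} (UNIV :: 'd set)"
      by (rule bij_betw_nth_element)
  next
    fix i j and c :: complex and y :: "('p, 'q, 'l) symbol \<times> 'd \<Rightarrow> complex"
    assume ij: "i < j" "j < n"
    then have "\<beta> i \<noteq> \<beta> j" using inj by (auto simp: inj_on_def)
    then have "(\<lambda>z. (Neg (\<beta> i), snd z)) ` ({Neg (\<beta> j)} \<times> UNIV) \<inter> ({Neg (\<beta> j)} \<times> UNIV)
        = ({} :: (('p, 'q, 'l) symbol \<times> 'd) set)" by auto
    moreover have "shift_deriv ({Neg (\<beta> j)} \<times> UNIV) (\<lambda>z. (Neg (\<beta> i), snd z)) (u {}) = 0"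
      using fun_cong[OF row_shear[OF ij], of "{}"] by (simp add: superpol_Neg_at_empty pointwise)
    ultimately have "eval_mpoly (\<lambda>x. if x \<in> {Neg (\<beta> j)} \<times> UNIV then y x + c * y (Neg (\<beta> i), snd x) else y x) (u {})
        = eval_mpoly y (u {})"
      by (rule shift_deriv_eq_zero_iff[THEN iffD1, rule_format])
    then show "eval_mpoly (\<lambda>x. if fst x = Neg (\<beta> j) then y x + c * y (Neg (\<beta> i), snd x) else y x) (u {})
        = eval_mpoly y (u {})"
      by (simp add: mem_Times_iff)
  next
    fix i and c :: complex and y :: "('p, 'q, 'l) symbol \<times> 'd \<Rightarrow> complex"
    assume i: "i < n" "c \<noteq> 0"
    have "shift_deriv ({Neg (\<beta> i)} \<times> UNIV) (\<lambda>z. (Neg (\<beta> i), snd z)) (u {}) = const (of_nat (?lam i)) * u {}"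
      using fun_cong[OF row_weight[OF i(1)], of "{}"]
      by (simp add: superpol_Neg_at_empty pointwise scalar_def)
    then have eigen: "shift_deriv ({Neg (\<beta> i)} \<times> UNIV) id (u {}) = const (of_nat (?lam i)) * u {}"
      by (simp add: shift_deriv_def sum_singleton_Times)
    have "eval_mpoly (\<lambda>x. if x \<in> {Neg (\<beta> i)} \<times> UNIV then c * y x else y x) (u {})
        = c ^ ?lam i * eval_mpoly y (u {})"
      using eigen[THEN shift_deriv_id_eigen_iff[THEN iffD1], rule_format, OF i(2)] .
    then show "eval_mpoly (\<lambda>x. if fst x = Neg (\<beta> i) then c * y x else y x) (u {})
        = c ^ ?lam i * eval_mpoly y (u {})"
      by (simp add: mem_Times_iff)
  next
    fix i j and c :: complex and y :: "('p, 'q, 'l) symbol \<times> 'd \<Rightarrow> complex"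
    assume ij: "i < j" "j < CARD('d)"
    then have "nth_element i \<noteq> (nth_element j :: 'd)" by (simp add: nth_element_eq_iff)
    then have "(\<lambda>x. (fst x, nth_element i)) ` ((- range Pos) \<times> {nth_element j})
        \<inter> ((- range Pos) \<times> {nth_element j}) = ({} :: (('p, 'q, 'l) symbol \<times> 'd) set)" by auto
    moreover have "shift_deriv ((- range Pos) \<times> {nth_element j}) (\<lambda>x. (fst x, nth_element i)) (u {}) = 0"
      using fun_cong[OF col_shear[OF ij], of "{}"] by (simp add: colpol_at_empty pointwise)
    ultimately have "eval_mpoly (\<lambda>x. if x \<in> (- range Pos) \<times> {nth_element j}
          then y x + c * y (fst x, nth_element i) else y x) (u {})
        = eval_mpoly y (u {})"
      by (rule shift_deriv_eq_zero_iff[THEN iffD1, rule_format])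
    then show "eval_mpoly (\<lambda>x. if fst x \<in> - range Pos \<and> snd x = nth_element j
          then y x + c * y (fst x, nth_element i) else y x) (u {})
        = eval_mpoly y (u {})"
      by (simp add: mem_Times_iff)
  next
    fix i and c :: complex and y :: "('p, 'q, 'l) symbol \<times> 'd \<Rightarrow> complex"
    assume i: "i < CARD('d)" "c \<noteq> 0"
    have "shift_deriv ((- range Pos) \<times> {nth_element i}) (\<lambda>x. (fst x, nth_element i)) (u {})
        = const (of_nat (mu i)) * u {}"
      using fun_cong[OF col_weight[OF i(1)], of "{}"]
      by (simp add: colpol_at_empty pointwise scalar_def)
    then have eigen: "shift_deriv ((- range Pos) \<times> {nth_element i}) id (u {}) = const (of_nat (mu i)) * u {}"
      by (simp add: shift_deriv_def sum_Times_singleton)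
    have "eval_mpoly (\<lambda>x. if x \<in> (- range Pos) \<times> {nth_element i} then c * y x else y x) (u {})
        = c ^ mu i * eval_mpoly y (u {})"
      using eigen[THEN shift_deriv_id_eigen_iff[THEN iffD1], rule_format, OF i(2)] .
    then show "eval_mpoly (\<lambda>x. if fst x \<in> - range Pos \<and> snd x = nth_element i then c * y x else y x) (u {})
        = c ^ mu i * eval_mpoly y (u {})"
      by (simp add: mem_Times_iff)
  next
    show "(\<lambda>i. Neg (\<beta> i)) ` {..<n} \<subseteq> - range Pos" by auto
  qed (use i0 in simp_all)
  then have "u A = 0 A" for A
    unfolding zero_fun_apply by (cases "A = {}") (simp only:, rule u_off)
  then have "u = 0" by (rule ext)
  then show ?thesis unfolding u_def superpols_simps .
qed

section \<open>Action of the Schur elements\<close>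

lemma action_zero [simp]: "action 0 f = 0"
  unfolding zero_uea_def action.abs_eq by simp

lemma action_add: "action (x + y) f = action x f + action y f"
proof (induction x rule: uea.abs_induct)
  case (1 x)
  show ?case
    by (induction y rule: uea.abs_induct)
      (simp only: plus_uea.abs_eq action.abs_eq tensor_action_add_left)
qed

lemma action_sum: "action (\<Sum>i\<in>I. x i) f = (\<Sum>i\<in>I. action (x i) f)"
  by (induction I rule: infinite_finite_induct) (simp_all add: action_add)

lemma action_scale: "action (c *\<^sub>U x) f = const c * action x f"
proof (induction x rule: uea.abs_induct)
  case (1 x)
  show ?case
    by (simp add: scale_uea.abs_eq action.abs_eq tensor_action_mult tensor_action_single
        word_action_def zero_word_def)
qed

text \<open>The first indices run through S, C, D, C and the second ones through C, D, C, T, so the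
  word is balanced in the virtual symbols and lies in \<open>Virt\<close>.\<close>

lemma double_Young_Capelli_action:
  fixes v :: "('l::finite, 'd::finite) mpoly"
    and \<alpha> :: "nat \<Rightarrow> 'p::finite" and \<beta> :: "nat \<Rightarrow> 'q::finite"
  assumes "S \<in> tableaux p" "T \<in> tableaux p"
  shows "(inclusion (action (double_Young_Capelli \<alpha> \<beta> p S T) v) :: ('p, 'q, 'l, 'd) superpoly) =
    superpols (zip (concat (map (map Proper) S)) (concat (C_star \<alpha> p)))
      (superpols (zip (concat (C_star \<alpha> p)) (concat (D_star \<beta> p)))
        (superpols (zip (concat (D_star \<beta> p)) (concat (C_star \<alpha> p)))
          (superpols (zip (concat (C_star \<alpha> p)) (concat (map (map Proper) T))) (inclusion v))))"
proof -
  let ?S = "concat (map (map Proper) S) :: ('p, 'q, 'l) symbol list"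
  let ?T = "concat (map (map Proper) T) :: ('p, 'q, 'l) symbol list"
  let ?C = "concat (C_star \<alpha> p) :: ('p, 'q, 'l) symbol list"
  let ?D = "concat (D_star \<beta> p) :: ('p, 'q, 'l) symbol list"
  let ?w = "zip ?S ?C @ zip ?C ?D @ zip ?D ?C @ zip ?C ?T"
  have len: "length ?S = sum_list p" "length ?T = sum_list p"
    using assms[THEN length_concat_tableau] by (simp_all add: length_concat comp_def)
  have "virtual_balanced ?w"
    by (simp add: virtual_balanced_def map_fst_zip map_snd_zip len count_list_concat_Proper)
  then have "superaction (e_word ?w) (inclusion v :: ('p, 'q, 'l, 'd) superpoly)
      = inclusion (action (devirt (e_word ?w)) v)"
    by (intro superaction_devirt e_word_Virt)
  then show ?thesis
    by (simp add: double_Young_Capelli_def e_tableaux_def superaction_mult superaction_e_word mult.assoc)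
qed

theorem theorem4p3:
  fixes lam mu :: "nat list"
    and \<alpha> :: "nat \<Rightarrow> 'p::finite"
    and \<beta> :: "nat \<Rightarrow> 'q::finite"
    and v :: "('l::{finite, linorder}, 'd::{finite, linorder}) mpoly"
  assumes "is_partition lam" and "is_partition mu"
    and "part (conj_partition lam) 0 \<le> CARD('l)"
    and "part (conj_partition mu) 0 \<le> CARD('l)"
    and "part (conj_partition mu) 0 \<le> CARD('d)"
    and "inj_on \<alpha> {..<length (conj_partition lam)}"
    and "inj_on \<beta> {..<part (conj_partition lam) 0}"
    and "v = highest_weight_vector (conj_partition mu) \<or> v = - highest_weight_vector (conj_partition mu)"
    and "\<not> ferrers lam \<subseteq> ferrers mu"
  shows "action (schur_element \<alpha> \<beta> lam) v = 0"
proof -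
  let ?p = "conj_partition lam" and ?q = "conj_partition mu"
  obtain i j where "(i, j) \<in> ferrers lam" "(i, j) \<notin> ferrers mu"
    using assms(9) by auto
  then have i: "part mu i < part lam i" by (simp add: ferrers_def)
  have q: "k \<le> CARD('d)" if "k \<in> set ?q" for k
    using conj_partition_le[OF assms(2) that] assms(5) by simp
  have shear: "shift_deriv (UNIV \<times> {nth_element b}) (\<lambda>x. (fst x, nth_element a)) v = 0"
    if "a < b" "b < CARD('d)" for a b
  proof -
    have "(\<lambda>x. (fst x, nth_element a)) ` (UNIV \<times> {nth_element b}) \<inter> (UNIV \<times> {nth_element b})
        = ({} :: ('l \<times> 'd) set)"
      using that by (auto simp: nth_element_eq_iff)
    then show ?thesis
      using assms(8) eval_highest_weight_vector_shear[where q = ?q, OF that q]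
      by (subst shift_deriv_eq_zero_iff) (auto simp: eval_mpoly.hom_uminus)
  qed
  have weight: "shift_deriv (UNIV \<times> {nth_element a}) id v = const (of_nat (part mu a)) * v"
    if "a < CARD('d)" for a
    using assms(8) eval_highest_weight_vector_scale[where q = ?q, OF that q]
    by (subst shift_deriv_id_eigen_iff)
      (auto simp: eval_mpoly.hom_uminus length_filter_conj_partition[OF assms(2)])
  have "action (double_Young_Capelli \<alpha> \<beta> ?p S S) v = 0" if "S \<in> tableaux ?p" for S
  proof (rule inclusion_eq_zero_imp)
    \<comment> \<open>The row i with \<open>part mu i < part lam i\<close> serves as
      \<open>i0\<close>. It is a nonempty row of \<open>lam\<close>, hence below the length n of the
      longest row of the shape.\<close>
    have "superpols (zip (concat (D_star \<beta> ?p)) (concat (C_star \<alpha> ?p)))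
      (superpols (zip (concat (C_star \<alpha> ?p)) (concat (map (map Proper) S)))
        (inclusion v :: ('p, 'q, 'l, 'd) superpoly)) = 0"
      using assms(7) conj_partition_le[OF assms(1)] that shear weight
      by (rule superpols_D_C_T_eq_zero[where n = "part ?p 0" and ?i0.0 = i])
        (use i less_part_conj_partition[OF assms(1), of i] in
          \<open>simp_all add: length_filter_conj_partition[OF assms(1)]\<close>)
    then show "inclusion (action (double_Young_Capelli \<alpha> \<beta> ?p S S) v) = (0 :: ('p, 'q, 'l, 'd) superpoly)"
      by (simp add: double_Young_Capelli_action[OF that that])
  qed
  \<comment> \<open>Row i of \<open>lam\<close> is nonempty, which excludes the case where the Schur
    element is 1.\<close>
  moreover have "lam \<noteq> []" using i by (auto simp: part_def)
  ultimately show ?thesis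
    by (simp add: schur_element_def action_scale action_sum)
qed

end
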